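(* Let $G$ be a right-angled Artin group (defined by an arbitrary, possibly infinite, simplicial graph). Then $\operatorname{scl}(g)\ge 1/24$ for every nontrivial $g\in G$.
   Context: For a simplicial graph $\Gamma$ with vertex set $V(\Gamma)$ and edge set $E(\Gamma)$, the right-angled Artin group $A_\Gamma$ has generating set $V(\Gamma)$ and defining relations $[v,w]=1$ for each edge $\{v,w\}\in E(\Gamma)$. For $g\in[G,G]$, $\operatorname{cl}(g)$ is the least number of commutators whose product is $g$, and $\operatorname{scl}(g)=\lim_{n\to\infty}\operatorname{cl}(g^n)/n$. If $g^n\in[G,G]$ for some $n\geq 1$, set $\operatorname{scl}(g)=\operatorname{scl}(g^n)/n$; if no positive power of $g$ lies in $[G,G]$, $\operatorname{scl}(g)=\infty$. *)

theory Defs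
  imports "HOL-Algebra.Generated_Groups" "HOL-Library.Extended_Real"
begin

text \<open>
  A letter \<open>(x, True)\<close> stands for the generator \<open>x\<close>, and \<open>(x, False)\<close> for its formal inverse.
\<close>

definition gwords :: "'a set \<Rightarrow> ('a \<times> bool) list set" where
  "gwords S = lists (S \<times> UNIV)"

inductive_set pres_rel :: "'a set \<Rightarrow> ('a \<times> bool) list set \<Rightarrow> (('a \<times> bool) list \<times> ('a \<times> bool) list) set"
  for S :: "'a set" and R :: "('a \<times> bool) list set" where
  refl: "u \<in> gwords S \<Longrightarrow> (u, u) \<in> pres_rel S R"
| sym: "(u, v) \<in> pres_rel S R \<Longrightarrow> (v, u) \<in> pres_rel S R"
| trans: "(u, v) \<in> pres_rel S R \<Longrightarrow> (v, w) \<in> pres_rel S R \<Longrightarrow> (u, w) \<in> pres_rel S R"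
| cancel: "u \<in> gwords S \<Longrightarrow> v \<in> gwords S \<Longrightarrow> x \<in> S \<Longrightarrow>
    (u @ [(x, b), (x, \<not> b)] @ v, u @ v) \<in> pres_rel S R"
| relator: "u \<in> gwords S \<Longrightarrow> v \<in> gwords S \<Longrightarrow> r \<in> R \<Longrightarrow> r \<in> gwords S \<Longrightarrow>
    (u @ r @ v, u @ v) \<in> pres_rel S R"

definition presented_group :: "'a set \<Rightarrow> ('a \<times> bool) list set \<Rightarrow> ('a \<times> bool) list set monoid" where
  "presented_group S R =
    \<lparr>carrier = gwords S // pres_rel S R,
     mult = (\<lambda>A B. \<Union>u\<in>A. \<Union>v\<in>B. pres_rel S R `` {u @ v}),
     one = pres_rel S R `` {[]}\<rparr>"

lemma gwords_Nil [simp]: "[] \<in> gwords S"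
  by (simp add: gwords_def)

lemma gwords_append [simp]: "u @ v \<in> gwords S \<longleftrightarrow> u \<in> gwords S \<and> v \<in> gwords S"
  by (simp add: gwords_def)

lemma gwords_Cons [simp]: "p # v \<in> gwords S \<longleftrightarrow> fst p \<in> S \<and> v \<in> gwords S"
  by (cases p) (simp add: gwords_def)

lemma pres_rel_gwords: "(u, v) \<in> pres_rel S R \<Longrightarrow> u \<in> gwords S \<and> v \<in> gwords S"
  by (induction rule: pres_rel.induct) auto

lemma equiv_pres_rel: "equiv (gwords S) (pres_rel S R)"
proof (rule equivI)
  show "pres_rel S R \<subseteq> gwords S \<times> gwords S" by (auto dest: pres_rel_gwords)
  show "refl_on (gwords S) (pres_rel S R)"
    by (rule refl_onI) (rule pres_rel.refl)
  show "Relation.sym (pres_rel S R)" by (rule symI) (rule pres_rel.sym)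
  show "Relation.trans (pres_rel S R)" by (rule transI) (rule pres_rel.trans)
qed

lemma pres_rel_context:
  assumes "(u, v) \<in> pres_rel S R" "a \<in> gwords S" "b \<in> gwords S"
  shows "(a @ u @ b, a @ v @ b) \<in> pres_rel S R"
  using assms
proof (induction rule: pres_rel.induct)
  case (refl u)
  then show ?case by (intro pres_rel.refl) auto
next
  case (sym u v)
  then show ?case using pres_rel.sym by simp
next
  case (trans u v w)
  then show ?case using pres_rel.trans[of "a @ u @ b" "a @ v @ b"] by simp
next
  case (cancel u v x c)
  then show ?case using pres_rel.cancel[of "a @ u" S "v @ b" x c R] by simp
next
  case (relator u v r)
  then show ?case using pres_rel.relator[of "a @ u" S "v @ b" r R] by simp
qed

lemma pres_rel_append:
  assumes "(u, u') \<in> pres_rel S R" "(v, v') \<in> pres_rel S R"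
  shows "(u @ v, u' @ v') \<in> pres_rel S R"
proof -
  have "(u @ v, u' @ v) \<in> pres_rel S R"
    using pres_rel_context[OF assms(1), of "[]" v] pres_rel_gwords[OF assms(2)] by simp
  moreover have "(u' @ v, u' @ v') \<in> pres_rel S R"
    using pres_rel_context[OF assms(2), of u' "[]"] pres_rel_gwords[OF assms(1)] by simp
  ultimately show ?thesis by (rule pres_rel.trans)
qed

lemma pres_mult_class:
  assumes "u \<in> gwords S" "v \<in> gwords S"
  shows "pres_rel S R `` {u} \<otimes>\<^bsub>presented_group S R\<^esub> pres_rel S R `` {v} = pres_rel S R `` {u @ v}"
proof -
  have "pres_rel S R `` {a @ b} = pres_rel S R `` {u @ v}"
    if "(u, a) \<in> pres_rel S R" "(v, b) \<in> pres_rel S R" for a b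
    using equiv_class_eq[OF equiv_pres_rel pres_rel_append[OF that]] by simp
  moreover have "(u, u) \<in> pres_rel S R" "(v, v) \<in> pres_rel S R"
    using assms by (auto intro: pres_rel.refl)
  ultimately have "(\<Union>a\<in>pres_rel S R `` {u}. \<Union>b\<in>pres_rel S R `` {v}. pres_rel S R `` {a @ b})
      = pres_rel S R `` {u @ v}" by blast
  then show ?thesis by (simp add: presented_group_def)
qed

lemma pres_inverse_word:
  assumes "u \<in> gwords S"
  shows "(map (\<lambda>(x, b). (x, \<not> b)) (rev u) @ u, []) \<in> pres_rel S R"
  using assms
proof (induction u)
  case Nil
  then show ?case by (auto intro: pres_rel.refl)
next
  case (Cons p u)
  obtain x b where p: "p = (x, b)" by (cases p)
  let ?i = "map (\<lambda>(x, b). (x, \<not> b)) (rev u)"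
  have "?i \<in> gwords S" using Cons.prems by (auto simp: gwords_def)
  then have "(?i @ [(x, \<not> b), (x, b)] @ u, ?i @ u) \<in> pres_rel S R"
    using pres_rel.cancel[of ?i S u x "\<not> b" R] Cons.prems p by simp
  moreover have "(?i @ u, []) \<in> pres_rel S R" using Cons by simp
  ultimately have "(?i @ [(x, \<not> b), (x, b)] @ u, []) \<in> pres_rel S R" by (rule pres_rel.trans)
  then show ?case by (simp add: p)
qed

lemma presented_group_is_group: "group (presented_group S R)"
proof (rule groupI)
  let ?G = "presented_group S R"
  have car: "A \<in> carrier ?G \<longleftrightarrow> (\<exists>u\<in>gwords S. A = pres_rel S R `` {u})" for A
    by (auto simp: presented_group_def quotient_def)
  have one: "\<one>\<^bsub>?G\<^esub> = pres_rel S R `` {[]}" by (simp add: presented_group_def)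
  show "\<one>\<^bsub>?G\<^esub> \<in> carrier ?G" by (auto simp: car one)
  show "A \<otimes>\<^bsub>?G\<^esub> B \<in> carrier ?G" if "A \<in> carrier ?G" "B \<in> carrier ?G" for A B
    using that unfolding car by (force simp: pres_mult_class)
  show "A \<otimes>\<^bsub>?G\<^esub> B \<otimes>\<^bsub>?G\<^esub> C = A \<otimes>\<^bsub>?G\<^esub> (B \<otimes>\<^bsub>?G\<^esub> C)"
    if "A \<in> carrier ?G" "B \<in> carrier ?G" "C \<in> carrier ?G" for A B C
    using that unfolding car by (auto simp: pres_mult_class)
  show "\<one>\<^bsub>?G\<^esub> \<otimes>\<^bsub>?G\<^esub> A = A" if "A \<in> carrier ?G" for A
    using that unfolding car one by (auto simp: pres_mult_class)
  show "\<exists>B\<in>carrier ?G. B \<otimes>\<^bsub>?G\<^esub> A = \<one>\<^bsub>?G\<^esub>" if A: "A \<in> carrier ?G" for A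
  proof -
    obtain u where u: "u \<in> gwords S" "A = pres_rel S R `` {u}" using A car by auto
    let ?i = "map (\<lambda>(x, b). (x, \<not> b)) (rev u)"
    have i: "?i \<in> gwords S" using u by (auto simp: gwords_def)
    have "pres_rel S R `` {?i} \<otimes>\<^bsub>?G\<^esub> A = \<one>\<^bsub>?G\<^esub>"
      unfolding u(2) one pres_mult_class[OF i u(1)]
      by (rule equiv_class_eq[OF equiv_pres_rel pres_inverse_word[OF u(1)]])
    with i show ?thesis using car by blast
  qed
qed

definition simplicial_graph :: "'a set \<Rightarrow> 'a set set \<Rightarrow> bool" where
  "simplicial_graph V E \<longleftrightarrow> E \<subseteq> {{v, w} | v w. v \<in> V \<and> w \<in> V \<and> v \<noteq> w}"

definition raag :: "'a set \<Rightarrow> 'a set set \<Rightarrow> ('a \<times> bool) list set monoid" where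
  "raag V E = presented_group V
    {[(v, True), (w, True), (v, False), (w, False)] | v w. {v, w} \<in> E}"

lemma raag_is_group: "group (raag V E)"
  unfolding raag_def by (rule presented_group_is_group)

text \<open>
  \<open>derived_set G (carrier G)\<close> is the set of commutators of \<open>G\<close>, and \<open>derived G (carrier G)\<close> is
  \<open>[G, G]\<close>. The values of \<open>cl\<close> and \<open>scl_derived\<close> are meaningful only for elements of \<open>[G, G]\<close>.
\<close>

definition cl :: "('a, 'b) monoid_scheme \<Rightarrow> 'a \<Rightarrow> nat" where
  "cl G g = (LEAST n. \<exists>cs. length cs = n \<and> set cs \<subseteq> derived_set G (carrier G) \<and>
                          foldr (\<otimes>\<^bsub>G\<^esub>) cs \<one>\<^bsub>G\<^esub> = g)"

definition scl_derived :: "('a, 'b) monoid_scheme \<Rightarrow> 'a \<Rightarrow> real" where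
  "scl_derived G g = lim (\<lambda>n. real (cl G (g [^]\<^bsub>G\<^esub> n)) / real n)"

text \<open>
  The choice of the least exponent is immaterial, see \<open>scl_eq\<close> below.
\<close>

definition scl :: "('a, 'b) monoid_scheme \<Rightarrow> 'a \<Rightarrow> ereal" where
  "scl G g =
    (if \<exists>n::nat. n \<ge> 1 \<and> g [^]\<^bsub>G\<^esub> n \<in> derived G (carrier G)
     then let n = (LEAST n::nat. n \<ge> 1 \<and> g [^]\<^bsub>G\<^esub> n \<in> derived G (carrier G))
          in ereal (scl_derived G (g [^]\<^bsub>G\<^esub> n) / real n)
     else \<infinity>)"

context group
begin

lemma foldr_mult_append:
  assumes "set xs \<subseteq> carrier G" "set ys \<subseteq> carrier G"
  shows "foldr (\<otimes>) ys \<one> \<in> carrier G"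
    and "foldr (\<otimes>) (xs @ ys) \<one> = foldr (\<otimes>) xs \<one> \<otimes> foldr (\<otimes>) ys \<one>"
proof -
  have c: "foldr (\<otimes>) zs \<one> \<in> carrier G" if "set zs \<subseteq> carrier G" for zs
    using that by (induction zs) auto
  then show "foldr (\<otimes>) ys \<one> \<in> carrier G" using assms by simp
  show "foldr (\<otimes>) (xs @ ys) \<one> = foldr (\<otimes>) xs \<one> \<otimes> foldr (\<otimes>) ys \<one>"
    using assms by (induction xs) (auto simp: c m_assoc)
qed

lemma commutators_in_carrier: "derived_set G (carrier G) \<subseteq> carrier G"
  by (rule derived_set_in_carrier) simp

lemma inv_commutator:
  assumes "c \<in> derived_set G (carrier G)"
  shows "inv c \<in> derived_set G (carrier G)"
proof -
  obtain a b where ab: "a \<in> carrier G" "b \<in> carrier G" "c = a \<otimes> b \<otimes> inv a \<otimes> inv b"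
    using assms by auto
  then have "inv c = b \<otimes> a \<otimes> inv b \<otimes> inv a" by (simp add: inv_mult_group m_assoc)
  with ab show ?thesis by auto
qed

lemma derived_commutator_list:
  assumes "g \<in> derived G (carrier G)"
  shows "\<exists>cs. set cs \<subseteq> derived_set G (carrier G) \<and> foldr (\<otimes>) cs \<one> = g"
proof -
  define C where "C = derived_set G (carrier G)"
  have CG: "C \<subseteq> carrier G" using commutators_in_carrier unfolding C_def .
  have invC: "inv c \<in> C" if "c \<in> C" for c
    using inv_commutator that unfolding C_def .
  have "g \<in> generate G C" using assms unfolding derived_def C_def .
  then have "\<exists>cs. set cs \<subseteq> C \<and> foldr (\<otimes>) cs \<one> = g"
  proof (induction rule: generate.induct)
    case one
    show ?case by (rule exI[of _ "[]"]) simp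
  next
    case (incl h)
    then have "h \<in> carrier G" using CG by blast
    with incl show ?case by (intro exI[of _ "[h]"]) simp
  next
    case (inv h)
    then have "h \<in> carrier G" using CG by blast
    with invC[OF inv] show ?case by (intro exI[of _ "[inv h]"]) simp
  next
    case (eng h1 h2)
    then obtain xs ys where *: "set xs \<subseteq> C" "foldr (\<otimes>) xs \<one> = h1"
      "set ys \<subseteq> C" "foldr (\<otimes>) ys \<one> = h2" by blast
    then have "foldr (\<otimes>) (xs @ ys) \<one> = h1 \<otimes> h2"
      using foldr_mult_append(2)[of xs ys] CG by blast
    with * show ?case by (intro exI[of _ "xs @ ys"]) simp
  qed
  then show ?thesis unfolding C_def .
qed

lemma cl_witness:
  assumes "g \<in> derived G (carrier G)"
  shows "\<exists>cs. length cs = cl G g \<and> set cs \<subseteq> derived_set G (carrier G) \<and> foldr (\<otimes>) cs \<one> = g"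
  unfolding cl_def by (rule LeastI_ex) (use derived_commutator_list[OF assms] in blast)

lemma cl_le:
  assumes "set cs \<subseteq> derived_set G (carrier G)" "foldr (\<otimes>) cs \<one> = g"
  shows "cl G g \<le> length cs"
  unfolding cl_def by (rule Least_le) (use assms in blast)

lemma cl_mult_le:
  assumes "g \<in> derived G (carrier G)" "h \<in> derived G (carrier G)"
  shows "cl G (g \<otimes> h) \<le> cl G g + cl G h"
proof -
  obtain xs ys where
    xs: "length xs = cl G g" "set xs \<subseteq> derived_set G (carrier G)" "foldr (\<otimes>) xs \<one> = g" and
    ys: "length ys = cl G h" "set ys \<subseteq> derived_set G (carrier G)" "foldr (\<otimes>) ys \<one> = h"
    using cl_witness assms by meson
  have "foldr (\<otimes>) (xs @ ys) \<one> = g \<otimes> h"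
    using foldr_mult_append(2)[OF subset_trans[OF xs(2) commutators_in_carrier]
        subset_trans[OF ys(2) commutators_in_carrier]] xs(3) ys(3) by (simp only:)
  moreover have "set (xs @ ys) \<subseteq> derived_set G (carrier G)"
    using Un_least[OF xs(2) ys(2)] by (simp only: set_append)
  ultimately have "cl G (g \<otimes> h) \<le> length (xs @ ys)" by (intro cl_le)
  with xs(1) ys(1) show ?thesis by simp
qed

end

lemma subadditive_average_convergent:
  fixes a :: "nat \<Rightarrow> nat"
  assumes sub: "\<And>m n. a (m + n) \<le> a m + a n"
  shows "convergent (\<lambda>n. real (a n) / real n)"
proof -
  define L where "L = (INF n\<in>{1..}. real (a n) / real n)"
  have bdd: "bdd_below ((\<lambda>n. real (a n) / real n) ` {1..})"
    by (rule bdd_belowI[of _ 0]) auto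
  have lower: "L \<le> real (a n) / real n" if "n \<ge> 1" for n
    unfolding L_def using bdd that by (intro cINF_lower) auto
  have mult: "a (q * m + r) \<le> q * a m + a r" for q m r
  proof (induction q)
    case (Suc q)
    have "a (Suc q * m + r) \<le> a m + a (q * m + r)"
      using sub[of m "q * m + r"] by (simp add: add.assoc)
    with Suc show ?case by simp
  qed simp
  have "(\<lambda>n. real (a n) / real n) \<longlonglongrightarrow> L"
  proof (rule LIMSEQ_I)
    fix e :: real assume e: "e > 0"
    have "\<exists>m\<in>{1..}. real (a m) / real m < L + e / 2"
      using cINF_less_iff[of "{1..}" "\<lambda>n. real (a n) / real n" "L + e / 2"] bdd e
      unfolding L_def[symmetric] by auto
    then obtain m where m: "m \<ge> 1" "real (a m) / real m < L + e / 2" by auto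
    define C where "C = Max (a ` {..<m})"
    have C: "a r \<le> C" if "r < m" for r unfolding C_def using that by simp
    obtain N :: nat where N: "real N > 2 * real C / e" using reals_Archimedean2 by blast
    have "norm (real (a n) / real n - L) < e" if n: "n \<ge> max N 1" for n
    proof -
      have n1: "real n > 0" using n by simp
      have "a n \<le> (n div m) * a m + a (n mod m)"
        using mult[of "n div m" m "n mod m"] by simp
      also have "\<dots> \<le> (n div m) * a m + C" using C[of "n mod m"] m by simp
      finally have "real (a n) \<le> real (n div m) * real (a m) + real C"
        by (metis of_nat_add of_nat_le_iff of_nat_mult)
      also have "\<dots> \<le> real n / real m * real (a m) + real C"
      proof (intro add_right_mono mult_right_mono)
        have "real (n div m) * real m \<le> real n"
          by (metis div_times_less_eq_dividend of_nat_le_iff of_nat_mult)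
        then show "real (n div m) \<le> real n / real m" using m by (simp add: pos_le_divide_eq)
      qed simp
      finally have "real (a n) / real n \<le> (real n / real m * real (a m) + real C) / real n"
        using n1 by (intro divide_right_mono) auto
      also have "\<dots> = real (a m) / real m + real C / real n"
        using n1 by (simp add: add_divide_distrib)
      finally have 1: "real (a n) / real n \<le> real (a m) / real m + real C / real n" .
      have "2 * real C / e < real n" using N n by linarith
      then have 2: "real C / real n < e / 2" using e n1 by (simp add: field_simps)
      have "L \<le> real (a n) / real n" using lower[of n] n by simp
      moreover have "real (a n) / real n < L + e" using 1 2 m(2) by argo
      ultimately show ?thesis by (simp add: abs_if)
    qed
    then show "\<exists>N. \<forall>n\<ge>N. norm (real (a n) / real n - L) < e" by blast
  qed
  then show ?thesis by (rule convergentI)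
qed

context group
begin

lemma derived_nat_pow:
  assumes "g \<in> derived G (carrier G)"
  shows "g [^] (n::nat) \<in> derived G (carrier G)"
proof -
  interpret D: subgroup "derived G (carrier G)" G by (rule derived_is_subgroup) simp
  show ?thesis by (induction n) (use assms in auto)
qed

lemma scl_derived_limit:
  assumes g: "g \<in> derived G (carrier G)"
  shows "(\<lambda>n. real (cl G (g [^] n)) / real n) \<longlonglongrightarrow> scl_derived G g"
proof -
  have gc: "g \<in> carrier G" using g derived_in_carrier[of "carrier G"] by auto
  have "cl G (g [^] (m + n)) \<le> cl G (g [^] m) + cl G (g [^] n)" for m n :: nat
    using cl_mult_le[OF derived_nat_pow[OF g, of m] derived_nat_pow[OF g, of n]]
    by (simp add: nat_pow_mult[OF gc])
  then have "convergent (\<lambda>n. real (cl G (g [^] n)) / real n)"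
    by (rule subadditive_average_convergent[of "\<lambda>n. cl G (g [^] n)"])
  then show ?thesis unfolding scl_derived_def convergent_LIMSEQ_iff .
qed

lemma scl_derived_pow:
  assumes g: "g \<in> derived G (carrier G)" and k: "k \<ge> 1"
  shows "scl_derived G (g [^] (k::nat)) = real k * scl_derived G g"
proof -
  have gc: "g \<in> carrier G" using g derived_in_carrier[of "carrier G"] by auto
  have "strict_mono (\<lambda>n::nat. k * n)" using k by (simp add: strict_mono_def)
  from LIMSEQ_subseq_LIMSEQ[OF scl_derived_limit[OF g] this]
  have "(\<lambda>n. real k * (real (cl G (g [^] (k * n))) / real (k * n))) \<longlonglongrightarrow> real k * scl_derived G g"
    by (intro tendsto_mult_left) (simp add: o_def)
  moreover have "real k * (real (cl G (g [^] (k * n))) / real (k * n))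
      = real (cl G ((g [^] k) [^] n)) / real n" for n
    using k by (simp add: nat_pow_pow[OF gc])
  ultimately show ?thesis
    using LIMSEQ_unique scl_derived_limit[OF derived_nat_pow[OF g, of k]] by (simp only:) blast
qed

lemma scl_eq:
  assumes g: "g \<in> carrier G" and n: "n \<ge> 1" "g [^] (n::nat) \<in> derived G (carrier G)"
  shows "scl G g = ereal (scl_derived G (g [^] n) / real n)"
proof -
  let ?P = "\<lambda>n::nat. n \<ge> 1 \<and> g [^] n \<in> derived G (carrier G)"
  define m where "m = (LEAST n. ?P n)"
  have m: "m \<ge> 1" "g [^] m \<in> derived G (carrier G)"
    using LeastI[of ?P n] n unfolding m_def by auto
  have "real n * scl_derived G (g [^] m) = scl_derived G ((g [^] m) [^] n)"
    using scl_derived_pow[OF m(2) n(1)] by simp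
  also have "\<dots> = scl_derived G ((g [^] n) [^] m)"
    by (simp add: nat_pow_pow[OF g] mult.commute)
  also have "\<dots> = real m * scl_derived G (g [^] n)"
    using scl_derived_pow[OF n(2) m(1)] by simp
  finally have "scl_derived G (g [^] m) / real m = scl_derived G (g [^] n) / real n"
    using m n by (simp add: field_simps)
  moreover have "\<exists>n. ?P n" using n by blast
  ultimately show ?thesis unfolding scl_def by (simp only: if_True Let_def m_def)
qed

end

end

theory Submission
  imports Defs "HOL-Library.Sublist"
begin

text \<open>
  By deleting vertices from a minimal support one may assume that \<open>g\<close> dies in every retraction
  \<open>\<kappa>\<close> that kills a single vertex \<open>v\<close> of its support. The kernel of \<open>\<kappa>\<close> is free on the conjugates
  \<open>\<kappa>(b) v \<kappa>(b)\<inverse>\<close>, and the whole group acts on the Cayley tree of this free group: \<open>v\<close> acts by left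
  multiplication, the other vertices by relabelling. Half-trees are nested, so counting disjoint
  translates of a fundamental segment of the axis of \<open>g\<close>, with sign, gives an odd quasimorphism
  whose defect, read off from a tripod, is at most 3. It grows linearly on the powers of \<open>g\<close>,
  since a translate occurring backwards on the axis would make \<open>g\<close> conjugate to its inverse.
  The latter is impossible:
  if \<open>h g h\<inverse> = g\<inverse>\<close>, then some \<open>g\<^sup>n h\<close> fixes a vertex of the tree of \<open>v\<close>, so \<open>h\<^sup>2 = (g\<^sup>n h)\<^sup>2\<close> is
  conjugate to \<open>\<kappa>(h\<^sup>2)\<close>; as this holds for every \<open>v\<close> in the support, \<open>h\<^sup>2\<close> is trivial,
  and then so are \<open>h\<close> and \<open>g\<close>. An odd quasimorphism of defect \<open>D\<close> and slope \<open>c\<close> gives \<open>scl(g) \<ge> c / (4 D)\<close>, here \<open>1 / 12\<close>.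
\<close>

subsection \<open>Reduced words\<close>

definition flip :: "'b \<times> bool \<Rightarrow> 'b \<times> bool" where
  "flip a = (fst a, \<not> snd a)"

lemma flip_simps [simp]: "flip (x, b) = (x, \<not> b)" "flip (flip a) = a" "flip a \<noteq> a" "a \<noteq> flip a"
  by (auto simp: flip_def prod_eq_iff)

abbreviation reduced :: "('b \<times> bool) list \<Rightarrow> bool" where
  "reduced \<equiv> successively (\<lambda>a b. b \<noteq> flip a)"

text \<open>On reduced words, this is left multiplication by a letter in the free group. Reduced
  words stand for the group elements, so no quotient is formed, and \<open>fmul u w\<close> is the
  reduced form of the product when \<open>w\<close> is reduced.\<close>

definition lmul :: "'b \<times> bool \<Rightarrow> ('b \<times> bool) list \<Rightarrow> ('b \<times> bool) list" where
  "lmul a w = (if w \<noteq> [] \<and> hd w = flip a then tl w else a # w)"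

abbreviation fmul :: "('b \<times> bool) list \<Rightarrow> ('b \<times> bool) list \<Rightarrow> ('b \<times> bool) list" where
  "fmul \<equiv> foldr lmul"

definition winv :: "('b \<times> bool) list \<Rightarrow> ('b \<times> bool) list" where
  "winv w = rev (map flip w)"

abbreviation relabel :: "('b \<Rightarrow> 'c) \<Rightarrow> ('b \<times> bool) list \<Rightarrow> ('c \<times> bool) list" where
  "relabel f \<equiv> map (apfst f)"

lemma winv_simps [simp]:
  "winv [] = []" "winv (a # w) = winv w @ [flip a]" "winv (u @ w) = winv w @ winv u"
  "length (winv w) = length w" "winv (winv w) = w" "winv w = [] \<longleftrightarrow> w = []"
  by (auto simp: winv_def rev_map o_def)

lemma reduced_lmul: "reduced w \<Longrightarrow> reduced (lmul a w)"
  by (cases w) (auto simp: lmul_def successively_Cons)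

lemma reduced_fmul: "reduced w \<Longrightarrow> reduced (fmul u w)"
  by (induction u) (auto simp: reduced_lmul)

lemma lmul_flip_lmul:
  assumes "reduced w"
  shows "lmul a (lmul (flip a) w) = w" "lmul (flip a) (lmul a w) = w"
proof -
  have *: "lmul a (lmul (flip a) w) = w" for a
    using assms by (cases w; cases "tl w") (auto simp: lmul_def)
  show "lmul a (lmul (flip a) w) = w" by (rule *)
  show "lmul (flip a) (lmul a w) = w" using *[of "flip a"] by simp
qed

lemma fmul_reduced_append: "reduced (u @ w) \<Longrightarrow> fmul u w = u @ w"
proof (induction u)
  case (Cons a u)
  then have "reduced (u @ w)" by (auto simp: successively_Cons)
  with Cons show ?case by (cases "u @ w") (auto simp: lmul_def successively_Cons)
qed simp

lemma fmul_Nil: "reduced u \<Longrightarrow> fmul u [] = u"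
  using fmul_reduced_append[of u "[]"] by simp

lemma fmul_lmul:
  assumes "reduced w"
  shows "fmul (lmul a u) w = lmul a (fmul u w)"
  using reduced_fmul[OF assms, of "tl u"] lmul_flip_lmul(1)[of "fmul (tl u) w" a]
  by (cases u) (auto simp: lmul_def)

lemma fmul_winv_left:
  "reduced w \<Longrightarrow> fmul (winv u) (fmul u w) = w"
  by (induction u arbitrary: w) (auto simp: lmul_flip_lmul reduced_fmul)

lemma fmul_inject:
  "reduced w \<Longrightarrow> reduced w' \<Longrightarrow> fmul u w = fmul u w' \<longleftrightarrow> w = w'"
  by (metis fmul_winv_left)

text \<open>All cancellation happens in one block \<open>e\<close>: as \<open>a # c\<close> is
  reduced, the letter \<open>a\<close> can cancel against \<open>d'\<close> only when
  \<open>c'\<close> is empty.\<close>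

lemma fmul_decompose:
  assumes "reduced c" "reduced d"
  obtains c' e d' where "c = c' @ e" "d = winv e @ d'" "fmul c d = c' @ d'"
proof -
  have "\<exists>c' e d'. c = c' @ e \<and> d = winv e @ d' \<and> fmul c d = c' @ d'"
    using assms(1)
  proof (induction c)
    case Nil
    have "[] = [] @ [] \<and> d = winv [] @ d \<and> fmul [] d = [] @ d" by simp
    then show ?case by (intro exI)
  next
    case (Cons a c)
    then have "reduced c" by (auto simp: successively_Cons)
    with Cons.IH obtain c' e d' where *: "c = c' @ e" "d = winv e @ d'" "fmul c d = c' @ d'"
      by blast
    show ?case
    proof (cases "c' @ d' \<noteq> [] \<and> hd (c' @ d') = flip a")
      case True
      then have "c' = []" using Cons.prems *(1) by (cases c') (auto simp: successively_Cons)
      moreover from True this obtain d'' where "d' = flip a # d''" by (cases d') auto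
      ultimately have "a # c = [] @ a # e \<and> d = winv (a # e) @ d'' \<and> fmul (a # c) d = [] @ d''"
        using * by (simp add: lmul_def)
      then show ?thesis by (intro exI)
    next
      case False
      then have "a # c = (a # c') @ e \<and> d = winv e @ d' \<and> fmul (a # c) d = (a # c') @ d'"
        using * by (auto simp: lmul_def)
      then show ?thesis by (intro exI)
    qed
  qed
  with that show ?thesis by blast
qed

lemma length_fmul_le:
  "length (fmul u w) \<le> length u + length w"
proof (induction u)
  case (Cons a u)
  have "length (lmul a x) \<le> Suc (length x)" for x by (auto simp: lmul_def)
  from this[of "fmul u w"] Cons show ?case by simp
qed simp

text \<open>In the Cayley tree of the free group, the left translate by \<open>u\<close> of the half-tree of
  words starting with \<open>l\<close> is a cylinder or the complement of one.\<close>

lemma starts_iff_fmul: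
  assumes u: "reduced u" and w: "reduced w"
  shows "prefix [l] w \<longleftrightarrow>
    (if u \<noteq> [] \<and> last u = flip l then \<not> prefix u (fmul u w) else prefix (u @ [l]) (fmul u w))"
proof -
  obtain c e d where *: "u = c @ e" "w = winv e @ d" "fmul u w = c @ d"
    using fmul_decompose[OF u w] .
  show ?thesis
  proof (cases e rule: rev_cases)
    case Nil
    moreover have "reduced (fmul u w)" using w by (rule reduced_fmul)
    ultimately show ?thesis using *
      by (cases w) (auto simp: successively_append_iff)
  next
    case (snoc e' a)
    \<comment> \<open>\<open>winv e\<close> ends in the inverse of the first letter of
      \<open>e\<close>, so a \<open>d\<close> starting with \<open>e\<close> would put a cancelling
      pair into \<open>w\<close>.\<close>
    have "\<not> prefix e d"
    proof
      assume "prefix e d"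
      then obtain d' where d: "d = e @ d'" by (auto simp: prefix_def)
      obtain b e'' where "e = b # e''" using snoc by (metis list.exhaust snoc_eq_iff_butlast)
      with d w *(2) show False by (auto simp: successively_append_iff)
    qed
    then have "\<not> prefix u (fmul u w)" "\<not> prefix (u @ [l]) (fmul u w)"
      using * by (auto dest: append_prefixD)
    then show ?thesis using * snoc by (auto simp: flip_simps(2) dest: arg_cong[of _ _ flip])
  qed
qed

section \<open>Relabellings and twisted translations of the tree\<close>

lemma flip_apfst: "flip (apfst f a) = apfst f (flip a)"
  by (simp add: flip_def)

lemma apfst_inject: "inj f \<Longrightarrow> apfst f a = apfst f b \<longleftrightarrow> a = b"
  by (cases a; cases b) (auto simp: inj_eq)

lemma reduced_relabel: "inj f \<Longrightarrow> reduced (relabel f w) \<longleftrightarrow> reduced w"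
  by (simp add: successively_map flip_apfst apfst_inject)

lemma relabel_lmul: "inj f \<Longrightarrow> relabel f (lmul a w) = lmul (apfst f a) (relabel f w)"
  by (cases w) (auto simp: lmul_def flip_apfst apfst_inject)

lemma relabel_fmul: "inj f \<Longrightarrow> relabel f (fmul u w) = fmul (relabel f u) (relabel f w)"
  by (induction u) (auto simp: relabel_lmul)

text \<open>A twisted translation \<open>w \<mapsto> c \<cdot> f(w)\<close> moving the root by more than its square does
  fixes the midpoint of \<open>c\<close>; the length of \<open>c\<close> is even since relabelling preserves signs.\<close>

lemma twisted_fixed_vertex:
  assumes c: "reduced c" and f: "inj f" and short: "length (fmul c (relabel f c)) < length c"
  shows "\<exists>k. fmul c (relabel f (take k c)) = take k c"
proof -
  have fc: "reduced (relabel f c)" using c f by (simp add: reduced_relabel)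
  obtain a e d where *: "c = a @ e" "relabel f c = winv e @ d" "fmul c (relabel f c) = a @ d"
    using fmul_decompose[OF c fc] .
  have len: "length c = length a + length e" "length c = length e + length d"
    using arg_cong[OF *(1), of length] arg_cong[OF *(2), of length] by simp_all
  \<comment> \<open>More than half of \<open>c\<close> cancels, so the matching of letters in
    \<open>nth\<close> reaches past the midpoint of \<open>c\<close>.\<close>
  with short *(3) have big: "length c < 2 * length e" by simp
  have nth: "apfst f (c ! i) = flip (c ! (length c - 1 - i))" if i: "i < length e" for i
  proof -
    have "apfst f (c ! i) = relabel f c ! i" using i len by simp
    also have "\<dots> = winv e ! i" using i by (simp add: *(2) nth_append)
    also have "\<dots> = flip (e ! (length e - 1 - i))" using i by (simp add: winv_def rev_nth)
    also have "e ! (length e - 1 - i) = c ! (length a + (length e - 1 - i))" by (simp add: *(1))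
    also have "length a + (length e - 1 - i) = length c - 1 - i" using i len by simp
    finally show ?thesis .
  qed
  define k where "k = length c div 2"
  have "even (length c)"
  proof (rule ccontr)
    assume "odd (length c)"
    then have "length c = 2 * k + 1" unfolding k_def by simp
    then have "apfst f (c ! k) = flip (c ! k)" using nth[of k] big by simp
    then show False by (cases "c ! k") simp
  qed
  then have k: "length c = 2 * k" unfolding k_def by simp
  \<comment> \<open>With \<open>p = take k c\<close> this says that \<open>c\<close> is
    \<open>p\<close> times the inverse of the relabelled \<open>p\<close>; hence \<open>p\<close> is
    fixed.\<close>
  have "drop k c = winv (relabel f (take k c))"
  proof (rule nth_equalityI)
    fix i assume "i < length (drop k c)"
    then have i: "i < k" using k by simp
    have "winv (relabel f (take k c)) ! i = flip (apfst f (c ! (k - 1 - i)))"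
      using i k by (simp add: winv_def rev_nth)
    also have "\<dots> = c ! (k + i)"
    proof -
      have "length c - 1 - (k - 1 - i) = k + i" using i k by simp
      then show ?thesis using nth[of "k - 1 - i"] i k big by simp
    qed
    finally show "drop k c ! i = winv (relabel f (take k c)) ! i" using i k by simp
  qed (simp add: k)
  moreover have r: "reduced (take k c)"
    using c append_take_drop_id[of k c] by (metis successively_append_iff)
  ultimately have "fmul (drop k c) (relabel f (take k c)) = []"
    using fmul_winv_left[of "[]" "relabel f (take k c)"] fmul_Nil[of "relabel f (take k c)"] f
    by (simp add: reduced_relabel)
  then have "fmul (take k c @ drop k c) (relabel f (take k c)) = take k c"
    by (simp only: foldr_append o_apply fmul_Nil[OF r])
  then show ?thesis by auto
qed

subsection \<open>Quasimorphisms from nested cuts\<close>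

text \<open>The easy half of Bavard duality, for quasimorphisms that need not be homogeneous. By
  oddness the values of the four factors of a commutator cancel, leaving at most 3 D; each further
  multiplication costs D. So \<open>q\<close> is at most 4 D times the commutator length, and
  \<open>C\<close> vanishes in the limit.\<close>

lemma (in group) scl_ge_of_quasimorphism:
  fixes q :: "'a \<Rightarrow> real"
  assumes quasi: "\<And>a b. a \<in> carrier G \<Longrightarrow> b \<in> carrier G \<Longrightarrow> \<bar>q (a \<otimes> b) - q a - q b\<bar> \<le> D"
    and odd: "\<And>a. a \<in> carrier G \<Longrightarrow> q (inv a) = - q a"
    and growth: "\<And>n::nat. q (g [^] n) \<ge> c * real n - C"
    and g: "g \<in> carrier G" and D: "D > 0"
  shows "scl G g \<ge> ereal (c / (4 * D))"
proof (cases "\<exists>n::nat. n \<ge> 1 \<and> g [^] n \<in> derived G (carrier G)")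
  case False
  then show ?thesis by (simp only: scl_def if_False) simp
next
  case True
  then obtain m :: nat where m: "m \<ge> 1" "g [^] m \<in> derived G (carrier G)" by blast
  have comm: "q x \<le> 3 * D" if x: "x \<in> derived_set G (carrier G)" for x
  proof -
    obtain a b where ab: "a \<in> carrier G" "b \<in> carrier G" "x = a \<otimes> b \<otimes> inv a \<otimes> inv b"
      using x by auto
    then show ?thesis
      using quasi[of "a \<otimes> b \<otimes> inv a" "inv b"] quasi[of "a \<otimes> b" "inv a"] quasi[of a b]
        odd[of a] odd[of b] by (simp add: abs_le_iff)
  qed
  have q1: "q \<one> = 0" using odd[of \<one>] by simp
  have prod: "q (foldr (\<otimes>) cs \<one>) \<le> 4 * D * length cs"
    if "set cs \<subseteq> derived_set G (carrier G)" for cs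
    using that
  proof (induction cs)
    case (Cons x cs)
    have sub: "set (x # cs) \<subseteq> carrier G"
      using Cons.prems commutators_in_carrier by (rule subset_trans)
    then have "foldr (\<otimes>) cs \<one> \<in> carrier G"
      using foldr_mult_append(1)[of "[]" cs] by simp
    moreover have "x \<in> carrier G" using sub by simp
    moreover have "q x \<le> 3 * D" using comm[of x] Cons.prems by (meson list.set_intros(1) subsetD)
    moreover have "q (foldr (\<otimes>) cs \<one>) \<le> 4 * D * length cs"
      using Cons.IH Cons.prems by (meson set_subset_Cons subset_trans)
    ultimately show ?case
      using quasi[of x "foldr (\<otimes>) cs \<one>"] by (simp add: abs_le_iff algebra_simps)
  qed (simp add: q1)
  have bound: "c * real m / (4 * D) - (C / (4 * D)) / real n \<le> real (cl G ((g [^] m) [^] n)) / real n"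
    if n: "n \<ge> 1" for n :: nat
  proof -
    obtain cs where cs: "length cs = cl G ((g [^] m) [^] n)"
      "set cs \<subseteq> derived_set G (carrier G)" "foldr (\<otimes>) cs \<one> = (g [^] m) [^] n"
      using cl_witness[OF derived_nat_pow[OF m(2)]] by blast
    have "c * real (m * n) - C \<le> q ((g [^] m) [^] n)"
      using growth[of "m * n"] g by (simp add: nat_pow_pow)
    also have "\<dots> \<le> 4 * D * real (cl G ((g [^] m) [^] n))"
      using prod[OF cs(2)] cs(1,3) by simp
    finally have "(c * real m * real n - C) / (4 * D * real n)
        \<le> 4 * D * real (cl G ((g [^] m) [^] n)) / (4 * D * real n)"
      using n D by (intro divide_right_mono) (simp_all add: mult.assoc)
    moreover have "(c * real m * real n - C) / (4 * D * real n) =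
        c * real m / (4 * D) - (C / (4 * D)) / real n"
      using n D by (simp add: field_simps)
    ultimately show ?thesis using D by simp
  qed
  have "(\<lambda>n. c * real m / (4 * D) - (C / (4 * D)) / real n) \<longlonglongrightarrow> c * real m / (4 * D) - 0"
    by (intro tendsto_diff tendsto_const lim_const_over_n)
  then have "c * real m / (4 * D) - 0 \<le> scl_derived G (g [^] m)"
    using bound by (intro LIMSEQ_le[OF _ scl_derived_limit[OF m(2)]]) auto
  then have "c / (4 * D) \<le> scl_derived G (g [^] m) / real m"
    using m(1) D by (simp add: field_simps)
  then show ?thesis using scl_eq[OF g m] by simp
qed

section \<open>Counting disjoint copies of a segment between nested cuts\<close>

locale nested_cut = group +
  fixes A g
  assumes A_sub: "A \<subseteq> carrier G" and g_in: "g \<in> A" and one_notin: "\<one> \<notin> A"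
    and shift: "x \<in> A \<Longrightarrow> g \<otimes> x \<in> A"
begin

definition tr :: "'a \<Rightarrow> 'a set" where
  "tr k = {x \<in> carrier G. inv k \<otimes> x \<in> A}"

text \<open>The pair \<open>tr k\<close>, \<open>tr (k \<otimes> g)\<close> bounds the translate by
  \<open>k\<close> of the segment between \<open>A\<close> and \<open>gA\<close>. A chain lists such
  copies in the order in which they are crossed from \<open>S\<close> to \<open>T\<close>, each
  starting only after the earlier ones have ended.\<close>

definition chain :: "'a set \<Rightarrow> 'a list \<Rightarrow> 'a set \<Rightarrow> bool" where
  "chain S ks T \<longleftrightarrow> set ks \<subseteq> carrier G \<and> sorted_wrt (\<lambda>k k'. tr k' \<subseteq> tr (k \<otimes> g)) ks \<and>
    (\<forall>k\<in>set ks. S \<inter> tr k = {} \<and> T \<subseteq> tr (k \<otimes> g))"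

text \<open>Sets as ends give the legs of a tripod: \<open>cnt {x} {y, z}\<close> counts copies on
  the part shared by the ways from \<open>x\<close> to \<open>y\<close> and to \<open>z\<close>. The
  maximum exists by \<open>finite_chain_lengths\<close>.\<close>

definition cnt :: "'a set \<Rightarrow> 'a set \<Rightarrow> nat" where
  "cnt S T = Max (length ` {ks. chain S ks T})"

end

text \<open>Nestedness makes the translates behave like half-trees, finiteness bounds the counts,
  and \<open>no_reverse\<close> excludes every copy on the way from \<open>g [^] n\<close> back to
  \<open>\<one>\<close>.\<close>

locale nested_cut_system = nested_cut +
  assumes nested: "\<And>h k. h \<in> carrier G \<Longrightarrow> k \<in> carrier G \<Longrightarrow>
      tr h \<subseteq> tr k \<or> tr k \<subseteq> tr h \<or> tr h \<inter> tr k = {} \<or> carrier G \<subseteq> tr h \<union> tr k"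
    and finite_separating: "\<And>x y. x \<in> carrier G \<Longrightarrow> y \<in> carrier G \<Longrightarrow>
      finite {tr k | k. k \<in> carrier G \<and> x \<notin> tr k \<and> y \<in> tr k}"
    and no_reverse: "\<And>k (n::nat). k \<in> carrier G \<Longrightarrow> g [^] n \<in> tr k \<or> \<one> \<notin> tr (k \<otimes> g)"

context nested_cut
begin

lemma gc: "g \<in> carrier G"
  using g_in A_sub by blast

lemma tr_mult: "h \<in> carrier G \<Longrightarrow> k \<in> carrier G \<Longrightarrow> x \<in> carrier G \<Longrightarrow>
    h \<otimes> x \<in> tr (h \<otimes> k) \<longleftrightarrow> x \<in> tr k"
  by (simp add: tr_def inv_mult_group m_assoc inv_solve_left')
    (simp add: m_assoc[symmetric])

lemma tr_translate:
  assumes hk: "h \<in> carrier G" "k \<in> carrier G"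
  shows "tr (h \<otimes> k) = (\<otimes>) h ` tr k"
proof (rule subset_antisym; rule subsetI)
  fix x assume x: "x \<in> tr (h \<otimes> k)"
  then have xc: "x \<in> carrier G" by (simp add: tr_def)
  have "x = h \<otimes> (inv h \<otimes> x)" using hk xc by (simp add: m_assoc[symmetric])
  moreover have "inv h \<otimes> x \<in> tr k"
    using tr_mult[of h k "inv h \<otimes> x"] hk xc x by (simp add: m_assoc[symmetric])
  ultimately show "x \<in> (\<otimes>) h ` tr k" by blast
next
  fix x assume "x \<in> (\<otimes>) h ` tr k"
  then show "x \<in> tr (h \<otimes> k)" using hk tr_mult by (auto simp: tr_def)
qed

lemma tr_shift_less:
  assumes k: "k \<in> carrier G"
  shows "tr (k \<otimes> g) \<subset> tr k"
proof
  show "tr (k \<otimes> g) \<subseteq> tr k"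
  proof
    fix x assume x: "x \<in> tr (k \<otimes> g)"
    then have xc: "x \<in> carrier G" and "inv (k \<otimes> g) \<otimes> x \<in> A" by (auto simp: tr_def)
    then have "g \<otimes> (inv (k \<otimes> g) \<otimes> x) \<in> A" using shift by blast
    moreover have "g \<otimes> (inv (k \<otimes> g) \<otimes> x) = inv k \<otimes> x"
      using k xc gc by (simp add: inv_mult_group m_assoc[symmetric])
    ultimately show "x \<in> tr k" using xc by (simp add: tr_def)
  qed
  have "k \<otimes> g \<in> tr k" using k gc g_in by (simp add: tr_def m_assoc[symmetric])
  moreover have "k \<otimes> g \<notin> tr (k \<otimes> g)" using k gc one_notin by (simp add: tr_def)
  ultimately show "tr (k \<otimes> g) \<noteq> tr k" by blast
qed

lemma chain_Nil [simp]: "chain S [] T"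
  by (simp add: chain_def)

lemma chain_translate:
  assumes "chain S ks T" "h \<in> carrier G" "S \<subseteq> carrier G"
  shows "chain ((\<otimes>) h ` S) (map ((\<otimes>) h) ks) ((\<otimes>) h ` T)"
proof -
  have sub: "k \<in> carrier G" if "k \<in> set ks" for k using assms(1) that by (auto simp: chain_def)
  have tg: "tr (h \<otimes> k \<otimes> g) = (\<otimes>) h ` tr (k \<otimes> g)" if "k \<in> carrier G" for k
    using tr_translate[OF assms(2), of "k \<otimes> g"] that gc assms(2) by (simp add: m_assoc)
  have inj: "inj_on ((\<otimes>) h) (carrier G)" using assms(2) by (simp add: inj_on_def)
  have trc: "tr k \<subseteq> carrier G" for k by (auto simp: tr_def)
  show ?thesis
    unfolding chain_def
  proof (intro conjI ballI)
    show "set (map ((\<otimes>) h) ks) \<subseteq> carrier G" using sub assms(2) by auto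
    show "sorted_wrt (\<lambda>k k'. tr k' \<subseteq> tr (k \<otimes> g)) (map ((\<otimes>) h) ks)"
      unfolding sorted_wrt_map
    proof (rule sorted_wrt_mono_rel)
      show "sorted_wrt (\<lambda>k k'. tr k' \<subseteq> tr (k \<otimes> g)) ks" using assms(1) by (simp add: chain_def)
    qed (simp add: tg sub tr_translate assms(2) image_mono)
    fix k' assume "k' \<in> set (map ((\<otimes>) h) ks)"
    then obtain k where k: "k \<in> set ks" "k' = h \<otimes> k" by auto
    then have "S \<inter> tr k = {}" "T \<subseteq> tr (k \<otimes> g)" using assms(1) by (auto simp: chain_def)
    then show "(\<otimes>) h ` S \<inter> tr k' = {}" "(\<otimes>) h ` T \<subseteq> tr (k' \<otimes> g)"
      using k sub[OF k(1)] assms(2,3) inj_on_image_Int[OF inj assms(3) trc, of k]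
      by (auto simp: tg tr_translate image_mono)
  qed
qed

end

context nested_cut_system
begin

text \<open>Along a chain the translates shrink strictly, so they are distinct, and all of them
  separate \<open>x\<close> from \<open>y\<close>.\<close>

lemma finite_chain_lengths:
  assumes x: "x \<in> S" "x \<in> carrier G" and y: "y \<in> T" "y \<in> carrier G"
  shows "finite (length ` {ks. chain S ks T})"
proof (rule finite_subset)
  let ?F = "{tr k | k. k \<in> carrier G \<and> x \<notin> tr k \<and> y \<in> tr k}"
  have "length ks \<le> card ?F" if ch: "chain S ks T" for ks
  proof -
    have kc: "k \<in> carrier G" if "k \<in> set ks" for k using ch that by (auto simp: chain_def)
    have "sorted_wrt (\<lambda>k k'. tr k' \<subseteq> tr (k \<otimes> g)) ks" using ch by (simp add: chain_def)
    then have "sorted_wrt (\<lambda>a b. b \<subset> a) (map tr ks)"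
      unfolding sorted_wrt_map
      by (rule sorted_wrt_mono_rel[rotated]) (use kc tr_shift_less in blast)
    then have "distinct (map tr ks)"
      unfolding distinct_conv_nth sorted_wrt_iff_nth_less by (metis linorder_neq_iff psubsetE subset_refl)
    moreover have "set (map tr ks) \<subseteq> ?F"
    proof -
      have "x \<notin> tr k \<and> y \<in> tr k" if "k \<in> set ks" for k
        using ch that x y tr_shift_less[OF kc[OF that]] unfolding chain_def by blast
      then show ?thesis using kc by auto
    qed
    ultimately show ?thesis
      using card_mono[OF finite_separating[OF x(2) y(2)], of "set (map tr ks)"]
        distinct_card[of "map tr ks"] by (simp only: length_map)
  qed
  then show "length ` {ks. chain S ks T} \<subseteq> {..card ?F}" by auto
qed simp

lemma cnt_ge:
  assumes "chain S ks T" "x \<in> S" "x \<in> carrier G" "y \<in> T" "y \<in> carrier G"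
  shows "length ks \<le> cnt S T"
  unfolding cnt_def by (rule Max_ge) (use assms finite_chain_lengths[OF assms(2-5)] in auto)

lemma cnt_witness:
  assumes "x \<in> S" "x \<in> carrier G" "y \<in> T" "y \<in> carrier G"
  obtains ks where "chain S ks T" "length ks = cnt S T"
proof -
  have "cnt S T \<in> length ` {ks. chain S ks T}"
    unfolding cnt_def by (rule Max_in) (use finite_chain_lengths[OF assms] chain_Nil in blast)+
  with that show ?thesis by auto
qed

text \<open>A chain from \<open>x\<close> to \<open>y\<close> is cut by \<open>z\<close> into a chain on the leg of \<open>x\<close> and one on the leg
  of \<open>y\<close> of the tripod \<open>x, y, z\<close>, with at most one copy straddling the centre.\<close>

lemma cnt_tripod_le:
  assumes xyz: "x \<in> carrier G" "y \<in> carrier G" "z \<in> carrier G"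
  shows "cnt {x} {y} \<le> cnt {x} {y, z} + cnt {x, z} {y} + 1"
proof -
  obtain ks where ks: "chain {x} ks {y}" "length ks = cnt {x} {y}"
    using cnt_witness[of x "{x}" y "{y}"] xyz by auto
  have kc: "k \<in> carrier G" if "k \<in> set ks" for k using ks(1) that by (auto simp: chain_def)
  have so: "sorted_wrt (\<lambda>k k'. tr k' \<subseteq> tr (k \<otimes> g)) (filter P ks)" for P
    using ks(1) by (intro sorted_wrt_filter) (simp add: chain_def)
  \<comment> \<open>Seen from \<open>z\<close>, the copies in \<open>ks1\<close> are already
    crossed, those in \<open>ks2\<close> not yet entered. Those in \<open>ks3\<close> contain
    \<open>z\<close> inside; a second one would start beyond the end of the first.\<close>
  define ks1 where "ks1 = filter (\<lambda>k. z \<in> tr (k \<otimes> g)) ks"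
  define ks2 where "ks2 = filter (\<lambda>k. z \<notin> tr k) ks"
  define ks3 where "ks3 = filter (\<lambda>k. z \<in> tr k \<and> z \<notin> tr (k \<otimes> g)) ks"
  have "chain {x} ks1 {y, z}" "chain {x, z} ks2 {y}"
    using ks(1) so unfolding ks1_def ks2_def chain_def by auto
  then have "length ks1 \<le> cnt {x} {y, z}" "length ks2 \<le> cnt {x, z} {y}"
    using cnt_ge[of "{x}" ks1 "{y, z}" x y] cnt_ge[of "{x, z}" ks2 "{y}" x y] xyz by simp_all
  moreover have "length ks3 \<le> 1"
  proof (rule ccontr)
    assume "\<not> length ks3 \<le> 1"
    then obtain k k' rest where eq: "ks3 = k # k' # rest" by (cases ks3; cases "tl ks3") auto
    then have "tr k' \<subseteq> tr (k \<otimes> g)" using so unfolding ks3_def[symmetric]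
      by (metis ks3_def list.set_intros(1) so sorted_wrt.simps(2))
    moreover have "k \<in> set ks3" "k' \<in> set ks3" using eq by auto
    ultimately show False by (auto simp: ks3_def)
  qed
  moreover have "length ks \<le> length ks1 + length ks2 + length ks3"
    unfolding ks1_def ks2_def ks3_def by (induction ks) auto
  ultimately show ?thesis using ks(2) by linarith
qed

text \<open>A chain on the leg of \<open>x\<close> followed by one on the leg of \<open>y\<close> is
  a chain from \<open>x\<close> to \<open>y\<close>. Of the four cases of nestedness,
  \<open>x\<close>, \<open>y\<close> and \<open>z\<close> rule out all but the required
  inclusion.\<close>

lemma cnt_tripod_ge:
  assumes xyz: "x \<in> carrier G" "y \<in> carrier G" "z \<in> carrier G"
  shows "cnt {x} {y, z} + cnt {x, z} {y} \<le> cnt {x} {y}"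
proof -
  obtain ks where ks: "chain {x} ks {y, z}" "length ks = cnt {x} {y, z}"
    using cnt_witness[of x "{x}" y "{y, z}"] xyz by auto
  obtain ls where ls: "chain {x, z} ls {y}" "length ls = cnt {x, z} {y}"
    using cnt_witness[of x "{x, z}" y "{y}"] xyz by auto
  have "tr l \<subseteq> tr (k \<otimes> g)" if "k \<in> set ks" "l \<in> set ls" for k l
  proof -
    have c: "k \<in> carrier G" "l \<in> carrier G" using that ks ls by (auto simp: chain_def)
    have "y \<in> tr (k \<otimes> g)" "z \<in> tr (k \<otimes> g)" "x \<notin> tr (k \<otimes> g)"
      using that ks tr_shift_less[OF c(1)] unfolding chain_def by auto
    moreover have "y \<in> tr l" "z \<notin> tr l" "x \<notin> tr l"
      using that ls tr_shift_less[OF c(2)] unfolding chain_def by auto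
    ultimately show ?thesis using nested[of l "k \<otimes> g"] c gc xyz by blast
  qed
  then have "chain {x} (ks @ ls) {y}"
    using ks ls by (auto simp: chain_def sorted_wrt_append)
  then have "length (ks @ ls) \<le> cnt {x} {y}" by (rule cnt_ge[of _ _ _ x y]) (simp_all add: xyz)
  with ks ls show ?thesis by simp
qed

lemma cnt_translate_le:
  assumes "h \<in> carrier G" "x \<in> carrier G" "y \<in> carrier G"
  shows "cnt {x} {y} \<le> cnt {h \<otimes> x} {h \<otimes> y}"
proof -
  obtain ks where ks: "chain {x} ks {y}" "length ks = cnt {x} {y}"
    using cnt_witness[of x "{x}" y "{y}"] assms by auto
  have "chain {h \<otimes> x} (map ((\<otimes>) h) ks) {h \<otimes> y}"
    using chain_translate[OF ks(1) assms(1)] assms by simp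
  then have "length (map ((\<otimes>) h) ks) \<le> cnt {h \<otimes> x} {h \<otimes> y}"
    by (rule cnt_ge[of _ _ _ "h \<otimes> x" "h \<otimes> y"]) (simp_all add: assms)
  with ks show ?thesis by simp
qed

lemma cnt_translate:
  assumes "h \<in> carrier G" "x \<in> carrier G" "y \<in> carrier G"
  shows "cnt {h \<otimes> x} {h \<otimes> y} = cnt {x} {y}"
  using cnt_translate_le[OF assms] cnt_translate_le[of "inv h" "h \<otimes> x" "h \<otimes> y"] assms
  by (simp add: m_assoc[symmetric])

text \<open>Copies crossed forwards minus copies crossed backwards, a counting quasimorphism in the
  style of Brooks.\<close>

definition qm :: "'a \<Rightarrow> real" where
  "qm x = real (cnt {\<one>} {x}) - real (cnt {x} {\<one>})"

lemma qm_inv: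
  assumes "x \<in> carrier G"
  shows "qm (inv x) = - qm x"
  using cnt_translate[of x \<one> "inv x"] cnt_translate[of x "inv x" \<one>] assms
  by (simp add: qm_def)

text \<open>Translation by \<open>a\<close> turns \<open>qm b\<close> into the side from
  \<open>a\<close> to \<open>a \<otimes> b\<close> of the tripod on \<open>\<one>\<close>,
  \<open>a\<close>, \<open>a \<otimes> b\<close>. Each of the six counts is a sum of two leg counts
  up to an error between 0 and 1. The leg counts cancel; three errors enter with each sign.\<close>

lemma qm_defect:
  assumes "a \<in> carrier G" "b \<in> carrier G"
  shows "\<bar>qm (a \<otimes> b) - qm a - qm b\<bar> \<le> 3"
proof -
  let ?e = \<one> and ?c = "a \<otimes> b"
  have c: "?c \<in> carrier G" using assms by simp
  have "qm b = real (cnt {a} {?c}) - real (cnt {?c} {a})"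
    using cnt_translate[of a \<one> b] cnt_translate[of a b \<one>] assms by (simp add: qm_def)
  moreover note ge = cnt_tripod_ge[OF one_closed assms(1) c] cnt_tripod_ge[OF assms(1) one_closed c]
    cnt_tripod_ge[OF assms(1) c one_closed] cnt_tripod_ge[OF c assms(1) one_closed]
    cnt_tripod_ge[OF one_closed c assms(1)] cnt_tripod_ge[OF c one_closed assms(1)]
  moreover note le = cnt_tripod_le[OF one_closed assms(1) c] cnt_tripod_le[OF assms(1) one_closed c]
    cnt_tripod_le[OF assms(1) c one_closed] cnt_tripod_le[OF c assms(1) one_closed]
    cnt_tripod_le[OF one_closed c assms(1)] cnt_tripod_le[OF c one_closed assms(1)]
  ultimately show ?thesis
    unfolding qm_def insert_commute[of a ?e] insert_commute[of ?c ?e] insert_commute[of ?c a]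
    by linarith
qed

lemma qm_pow_ge: "qm (g [^] (n::nat)) \<ge> real n - 1"
proof -
  have pow: "g [^] Suc i \<in> A" for i :: nat
  proof (induction i)
    case (Suc i)
    then show ?case using shift nat_pow_Suc2[OF gc, of "Suc i"] by simp
  qed (use g_in gc in simp)
  \<comment> \<open>If a negative power were in \<open>A\<close>, repeated shifts by
    \<open>g\<close> would bring \<open>\<one>\<close> into \<open>A\<close>.\<close>
  have pinv: "inv (g [^] i) \<notin> A" for i :: nat
  proof
    assume i: "inv (g [^] i) \<in> A"
    have "g [^] j \<otimes> inv (g [^] i) \<in> A" for j :: nat
    proof (induction j)
      case (Suc j)
      have "g [^] Suc j \<otimes> inv (g [^] i) = g \<otimes> (g [^] j \<otimes> inv (g [^] i))"
        unfolding nat_pow_Suc2[OF gc] using gc by (simp add: m_assoc)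
      with shift[OF Suc] show ?case by (simp only:)
    qed (use i gc in simp)
    from this[of i] one_notin gc show False by simp
  qed
  have quot: "inv (g [^] i) \<otimes> g [^] (i + j) = g [^] j" for i j :: nat
    using gc by (simp add: nat_pow_mult[symmetric] m_assoc[symmetric])
  \<comment> \<open>The copies at exponents 0 to n - 2. The copy at n - 1 ends in the cut
    \<open>tr (g [^] n)\<close>, which does not contain \<open>g [^] n\<close>.\<close>
  define ks where "ks = map (\<lambda>i. g [^] i) [0..<n - 1]"
  have mono: "tr (g [^] (i + j)) \<subseteq> tr (g [^] i)" for i j :: nat
  proof (induction j)
    case (Suc j)
    have "tr (g [^] (i + j) \<otimes> g) \<subseteq> tr (g [^] (i + j))" using tr_shift_less gc by blast
    with Suc show ?case by simp
  qed simp
  have "chain {\<one>} ks {g [^] n}"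
    unfolding chain_def
  proof (intro conjI ballI)
    show "set ks \<subseteq> carrier G" using gc by (auto simp: ks_def)
    have "tr (g [^] j) \<subseteq> tr (g [^] i \<otimes> g)" if "i < j" for i j :: nat
      using mono[of "Suc i" "j - Suc i"] that by simp
    then show "sorted_wrt (\<lambda>k k'. tr k' \<subseteq> tr (k \<otimes> g)) ks"
      unfolding ks_def sorted_wrt_map by (intro sorted_wrt_mono_rel[OF _ sorted_wrt_upt]) auto
    fix k assume "k \<in> set ks"
    then obtain i where i: "i < n - 1" "k = g [^] i" by (auto simp: ks_def)
    show "{\<one>} \<inter> tr k = {}" using pinv gc i by (simp add: tr_def)
    have "n = Suc i + Suc (n - i - 2)" using i by simp
    then have "inv (g [^] Suc i) \<otimes> g [^] n \<in> A" using quot[of "Suc i" "Suc (n - i - 2)"] pow by metis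
    then show "{g [^] n} \<subseteq> tr (k \<otimes> g)" using i gc by (simp add: tr_def)
  qed
  then have "length ks \<le> cnt {\<one>} {g [^] n}"
    by (rule cnt_ge[of _ _ _ \<one> "g [^] n"]) (simp_all add: gc)
  then have 1: "n - 1 \<le> cnt {\<one>} {g [^] n}" by (simp add: ks_def)
  obtain ls where ls: "chain {g [^] n} ls {\<one>}" "length ls = cnt {g [^] n} {\<one>}"
    using cnt_witness[of "g [^] n" "{g [^] n}" \<one> "{\<one>}"] gc by auto
  \<comment> \<open>A first member of the backward chain would be a copy forbidden by
    \<open>no_reverse\<close>.\<close>
  have "ls = []"
  proof (cases ls)
    case (Cons k ls')
    then have "k \<in> carrier G" "g [^] n \<notin> tr k" "\<one> \<in> tr (k \<otimes> g)"
      using ls(1) by (auto simp: chain_def)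
    then show ?thesis using no_reverse[of k n] by blast
  qed
  with 1 ls show ?thesis by (simp add: qm_def)
qed

end

subsection \<open>Retractions and tree actions of right-angled Artin groups\<close>

context group
begin

lemma commute_inv_left:
  assumes "a \<in> carrier G" "b \<in> carrier G" "a \<otimes> b = b \<otimes> a"
  shows "inv a \<otimes> b = b \<otimes> inv a"
proof -
  have "inv a \<otimes> b = inv a \<otimes> (b \<otimes> a) \<otimes> inv a" using assms(1,2) by (simp add: m_assoc)
  also have "\<dots> = b \<otimes> inv a" using assms by (simp add: assms(3)[symmetric] m_assoc[symmetric])
  finally show ?thesis .
qed

text \<open>The identity outside the carrier, which makes conjugation injective on the whole type,
  as relabelling requires.\<close>

definition cj :: "'a \<Rightarrow> 'a \<Rightarrow> 'a" where
  "cj k x = (if x \<in> carrier G then k \<otimes> x \<otimes> inv k else x)"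

lemma cj_closed: "k \<in> carrier G \<Longrightarrow> cj k x \<in> carrier G \<longleftrightarrow> x \<in> carrier G"
  by (simp add: cj_def)

lemma cj_mult: "a \<in> carrier G \<Longrightarrow> b \<in> carrier G \<Longrightarrow> cj (a \<otimes> b) = cj a \<circ> cj b"
  by (auto simp: cj_def fun_eq_iff m_assoc inv_mult_group)

lemma cj_one: "cj \<one> = id"
  by (auto simp: cj_def fun_eq_iff)

lemma inj_cj: "k \<in> carrier G \<Longrightarrow> inj (cj k)"
  using cj_mult[of "inv k" k] cj_one by (metis inj_on_id inj_on_imageI2 inv_closed l_inv)

text \<open>Evaluation in the group of a word whose letters are themselves group elements.\<close>

definition eps :: "('a \<times> bool) list \<Rightarrow> 'a" where
  "eps q = foldr (\<lambda>a r. (if snd a then fst a else inv (fst a)) \<otimes> r) q \<one>"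

lemma eps_Nil [simp]: "eps [] = \<one>"
  and eps_Cons: "eps (a # q) = (if snd a then fst a else inv (fst a)) \<otimes> eps q"
  by (simp_all add: eps_def)

lemma eps_closed: "fst ` set q \<subseteq> carrier G \<Longrightarrow> eps q \<in> carrier G"
  by (induction q) (auto simp: eps_Cons)

lemma eps_lmul:
  assumes "fst a \<in> carrier G" "fst ` set q \<subseteq> carrier G"
  shows "eps (lmul a q) = (if snd a then fst a else inv (fst a)) \<otimes> eps q"
proof (cases "q \<noteq> [] \<and> hd q = flip a")
  case True
  then obtain q' where "q = flip a # q'" by (cases q) auto
  then show ?thesis using assms eps_closed[of q']
    by (auto simp: lmul_def eps_Cons flip_def m_assoc[symmetric])
qed (auto simp: lmul_def eps_Cons)

lemma eps_relabel:
  assumes "k \<in> carrier G" "fst ` set q \<subseteq> carrier G"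
  shows "eps (relabel (cj k) q) = k \<otimes> eps q \<otimes> inv k"
  using assms(2)
proof (induction q)
  case (Cons a q)
  then have "eps q \<in> carrier G" by (simp add: eps_closed)
  with Cons show ?case using assms(1)
    by (auto simp: eps_Cons cj_def m_assoc inv_mult_group inv_solve_left')
qed (use assms(1) in simp)

end

section \<open>Words and their classes in a right-angled Artin group\<close>

locale raag_group = group G for G :: "('a \<times> bool) list set monoid" (structure) +
  fixes V :: "'a set" and E :: "'a set set"
  assumes G_eq: "G = raag V E"
begin

abbreviation rels :: "('a \<times> bool) list set" where
  "rels \<equiv> {[(v, True), (w, True), (v, False), (w, False)] | v w. {v, w} \<in> E}"

definition cls :: "('a \<times> bool) list \<Rightarrow> ('a \<times> bool) list set" where
  "cls w = pres_rel V rels `` {w}"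

lemma G_presented: "G = presented_group V rels"
  by (simp add: G_eq raag_def)

lemma cls_closed: "w \<in> gwords V \<Longrightarrow> cls w \<in> carrier G"
  by (auto simp: G_presented presented_group_def cls_def quotient_def)

lemma cls_cases:
  assumes "g \<in> carrier G"
  obtains w where "w \<in> gwords V" "g = cls w"
  using assms by (auto simp: G_presented presented_group_def cls_def quotient_def)

lemma cls_append: "u \<in> gwords V \<Longrightarrow> w \<in> gwords V \<Longrightarrow> cls (u @ w) = cls u \<otimes> cls w"
  using pres_mult_class[of u V w rels] by (simp add: G_presented cls_def)

lemma cls_Nil: "cls [] = \<one>"
  by (simp add: G_presented presented_group_def cls_def)

lemma cls_Cons: "fst a \<in> V \<Longrightarrow> w \<in> gwords V \<Longrightarrow> cls (a # w) = cls [a] \<otimes> cls w"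
  using cls_append[of "[a]" w] by simp

lemma cls_eqI: "(u, w) \<in> pres_rel V rels \<Longrightarrow> cls u = cls w"
  unfolding cls_def by (rule equiv_class_eq[OF equiv_pres_rel])

lemma cls_eqD: "cls u = cls w \<Longrightarrow> w \<in> gwords V \<Longrightarrow> (u, w) \<in> pres_rel V rels"
  unfolding cls_def by (rule eq_equiv_class[OF _ equiv_pres_rel])

lemma cls_inverse_letter:
  assumes x: "x \<in> V"
  shows "cls [(x, \<not> b)] = inv (cls [(x, b)])"
proof -
  have "cls [(x, \<not> b), (x, b)] = cls []"
    using pres_rel.cancel[of "[]" V "[]" x "\<not> b" rels] x by (intro cls_eqI) simp
  then have "cls [(x, \<not> b)] \<otimes> cls [(x, b)] = \<one>"
    using x by (simp add: cls_Cons[of "(x, \<not> b)" "[(x, b)]"] cls_Nil)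
  then show ?thesis using x by (intro inv_equality[symmetric]) (auto intro: cls_closed)
qed

lemma cls_commute:
  assumes xy: "x \<in> V" "y \<in> V" "{x, y} \<in> E"
  shows "cls [(x, b)] \<otimes> cls [(y, c)] = cls [(y, c)] \<otimes> cls [(x, b)]"
proof -
  define X where "X = cls [(x, True)]"
  define Y where "Y = cls [(y, True)]"
  have c: "X \<in> carrier G" "Y \<in> carrier G" using xy by (auto simp: X_def Y_def intro: cls_closed)
  have i: "cls [(x, False)] = inv X" "cls [(y, False)] = inv Y"
    using cls_inverse_letter[of _ True] xy by (simp_all add: X_def Y_def)
  have "cls [(x, True), (y, True), (x, False), (y, False)] = cls []"
    using pres_rel.relator[of "[]" V "[]" "[(x, True), (y, True), (x, False), (y, False)]" rels] xy
    by (intro cls_eqI) auto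
  then have "X \<otimes> (Y \<otimes> (inv X \<otimes> inv Y)) = \<one>"
    using xy i by (simp add: cls_Cons[of _ "_ # _"] cls_Nil X_def Y_def)
  then have "(X \<otimes> Y) \<otimes> inv (Y \<otimes> X) = \<one>"
    using c by (simp add: inv_mult_group m_assoc)
  then have XY: "X \<otimes> Y = Y \<otimes> X" using c by (metis inv_equality inv_inv m_closed inv_closed)
  note 1 = commute_inv_left[OF c XY] and 2 = commute_inv_left[OF c(2,1) XY[symmetric]]
  have 3: "inv X \<otimes> inv Y = inv Y \<otimes> inv X"
    using commute_inv_left[OF c(1) inv_closed[OF c(2)] 2[symmetric]] .
  show ?thesis
    using i XY 1 2 3 by (cases b; cases c) (simp_all add: X_def[symmetric] Y_def[symmetric])
qed

lemma letter_induct [consumes 1, case_names one letter]: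
  assumes g: "g \<in> carrier G" and one: "P \<one>"
    and letter: "\<And>x b h. x \<in> V \<Longrightarrow> h \<in> carrier G \<Longrightarrow> P h \<Longrightarrow> P (cls [(x, b)] \<otimes> h)"
  shows "P g"
proof -
  have "P (cls w)" if "w \<in> gwords V" for w
    using that
  proof (induction w)
    case (Cons a w)
    then show ?case using letter[of "fst a" "cls w" "snd a"] cls_Cons[of a w] by (auto intro: cls_closed)
  qed (simp add: cls_Nil one)
  then show ?thesis using cls_cases[OF g] by blast
qed

section \<open>Retractions that delete generators\<close>

definition rho :: "'a set \<Rightarrow> ('a \<times> bool) list set \<Rightarrow> ('a \<times> bool) list set" where
  "rho S g = cls (filter (\<lambda>p. fst p \<in> S) (SOME w. w \<in> gwords V \<and> g = cls w))"

lemma gwords_filter: "w \<in> gwords V \<Longrightarrow> filter P w \<in> gwords V"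
  by (auto simp: gwords_def)

text \<open>Makes \<open>rho\<close> independent of the chosen word: deletion leaves of a relator
  the relator itself, a cancelling pair, or nothing.\<close>

lemma cls_filter_cong:
  assumes "(u, w) \<in> pres_rel V rels"
  shows "cls (filter (\<lambda>p. fst p \<in> S) u) = cls (filter (\<lambda>p. fst p \<in> S) w)"
  using assms
proof (induction rule: pres_rel.induct)
  case (cancel u w x b)
  then show ?case
    using pres_rel.cancel[of "filter (\<lambda>p. fst p \<in> S) u" V "filter (\<lambda>p. fst p \<in> S) w" x b rels]
    by (auto simp: gwords_filter intro!: cls_eqI)
next
  case (relator u w r)
  let ?f = "filter (\<lambda>p. fst p \<in> S)"
  obtain x y where r: "r = [(x, True), (y, True), (x, False), (y, False)]" "{x, y} \<in> E"
    using relator by auto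
  have c: "?f u \<in> gwords V" "?f w \<in> gwords V" "x \<in> V" "y \<in> V"
    using relator r by (auto simp: gwords_filter)
  have "(?f u @ ?f r @ ?f w, ?f u @ ?f w) \<in> pres_rel V rels"
    using pres_rel.relator[of "?f u" V "?f w" r rels] c relator(3,4)
      pres_rel.cancel[of "?f u" V "?f w" x True rels] pres_rel.cancel[of "?f u" V "?f w" y True rels]
      pres_rel.refl[of "?f u @ ?f w" V rels] r
    by (cases "x \<in> S"; cases "y \<in> S") simp_all
  then show ?case using cls_eqI by simp
qed simp_all

lemma rho_cls:
  assumes "w \<in> gwords V"
  shows "rho S (cls w) = cls (filter (\<lambda>p. fst p \<in> S) w)"
proof -
  let ?w = "SOME u. u \<in> gwords V \<and> cls w = cls u"
  have "?w \<in> gwords V \<and> cls w = cls ?w" by (rule someI) (use assms in blast)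
  then have "(w, ?w) \<in> pres_rel V rels" by (intro cls_eqD) auto
  then show ?thesis unfolding rho_def by (rule cls_filter_cong[symmetric])
qed

lemma rho_group_hom: "group_hom G G (rho S)"
proof (intro group_hom.intro group_hom_axioms.intro homI is_group)
  fix g assume "g \<in> carrier G"
  then obtain w where w: "w \<in> gwords V" "g = cls w" by (rule cls_cases)
  show "rho S g \<in> carrier G"
    unfolding w(2) rho_cls[OF w(1)] by (intro cls_closed gwords_filter w(1))
next
  fix g h assume g: "g \<in> carrier G" and h: "h \<in> carrier G"
  obtain u where u: "u \<in> gwords V" "g = cls u" using g by (rule cls_cases)
  obtain w where w: "w \<in> gwords V" "h = cls w" using h by (rule cls_cases)
  have "rho S (cls (u @ w)) = rho S (cls u) \<otimes> rho S (cls w)"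
    using u(1) w(1) rho_cls[of "u @ w" S]
      cls_append[of "filter (\<lambda>p. fst p \<in> S) u" "filter (\<lambda>p. fst p \<in> S) w"]
    by (simp add: rho_cls gwords_filter)
  then show "rho S (g \<otimes> h) = rho S g \<otimes> rho S h"
    by (simp only: u(2) w(2) cls_append[OF u(1) w(1)])
qed

lemma rho_closed [simp]: "g \<in> carrier G \<Longrightarrow> rho S g \<in> carrier G"
  using group_hom.hom_closed[OF rho_group_hom] .

lemma rho_mult [simp]:
  "g \<in> carrier G \<Longrightarrow> h \<in> carrier G \<Longrightarrow> rho S (g \<otimes> h) = rho S g \<otimes> rho S h"
  using group_hom.hom_mult[OF rho_group_hom] .

lemma rho_one [simp]: "rho S \<one> = \<one>"
  using group_hom.hom_one[OF rho_group_hom] .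

lemma rho_inv [simp]: "g \<in> carrier G \<Longrightarrow> rho S (inv g) = inv (rho S g)"
  using group_hom.hom_inv[OF rho_group_hom] .

lemma rho_pow [simp]: "g \<in> carrier G \<Longrightarrow> rho S (g [^] (n::nat)) = rho S g [^] n"
  by (induction n) simp_all

lemma rho_letter: "x \<in> V \<Longrightarrow> rho S (cls [(x, b)]) = (if x \<in> S then cls [(x, b)] else \<one>)"
  by (simp add: rho_cls cls_Nil)

lemma rho_rho:
  assumes "g \<in> carrier G"
  shows "rho S (rho T g) = rho (S \<inter> T) g"
proof -
  obtain w where "w \<in> gwords V" "g = cls w" using assms by (rule cls_cases)
  then show ?thesis by (simp add: rho_cls gwords_filter conj_commute)
qed

lemma rho_empty:
  assumes "g \<in> carrier G"
  shows "rho {} g = \<one>"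
proof -
  obtain w where "w \<in> gwords V" "g = cls w" using assms by (rule cls_cases)
  then show ?thesis by (simp add: rho_cls cls_Nil)
qed

lemma finite_support:
  assumes "g \<in> carrier G"
  obtains S where "finite S" "S \<subseteq> V" "rho S g = g"
proof -
  obtain w where w: "w \<in> gwords V" "g = cls w" using assms by (rule cls_cases)
  have "filter (\<lambda>p. fst p \<in> fst ` set w) w = w" by (rule filter_True) simp
  then have "rho (fst ` set w) g = g" by (simp only: w(2) rho_cls[OF w(1)])
  moreover have "fst ` set w \<subseteq> V" using w(1) by (auto simp: gwords_def)
  ultimately show ?thesis by (intro that[of "fst ` set w"]) simp_all
qed

text \<open>Take a finite \<open>S\<close> of least size with nontrivial retract; killing one more
  vertex of \<open>S\<close> is the retraction onto a smaller set.\<close>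

lemma minimal_support:
  assumes g: "g \<in> carrier G" "g \<noteq> \<one>"
  obtains S where "finite S" "S \<subseteq> V" "S \<noteq> {}" "rho S g \<noteq> \<one>"
    "\<forall>v\<in>S. rho (- {v}) (rho S g) = \<one>"
proof -
  let ?P = "\<lambda>S. finite S \<and> S \<subseteq> V \<and> rho S g \<noteq> \<one>"
  obtain S0 where "finite S0" "S0 \<subseteq> V" "rho S0 g = g" using finite_support[OF g(1)] .
  then have "?P S0" using g(2) by simp
  then have "\<exists>S. ?P S \<and> (\<forall>T. ?P T \<longrightarrow> card S \<le> card T)"
    by (rule ex_has_least_nat[of ?P S0 card])
  then obtain S where S: "?P S" and least: "\<And>T. ?P T \<Longrightarrow> card S \<le> card T"
    by (elim exE) blast
  have "rho (- {v}) (rho S g) = \<one>" if v: "v \<in> S" for v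
  proof -
    have "card (S - {v}) < card S" using S v by (intro card_Diff1_less) auto
    then have "\<not> ?P (S - {v})" using least[of "S - {v}"] by linarith
    then have "rho (S - {v}) g = \<one>" using S by blast
    moreover have "- {v} \<inter> S = S - {v}" by blast
    ultimately show ?thesis by (simp only: rho_rho[OF g(1)])
  qed
  moreover have "S \<noteq> {}" using S rho_empty[OF g(1)] by blast
  ultimately show ?thesis using S by (intro that) auto
qed

text \<open>The vertices of \<open>S\<close> are killed one at a time: applying
  \<open>rho (- D)\<close> to the conjugacy at a new vertex \<open>v\<close> shows that
  \<open>z\<close> stays conjugate to its retract. Killing all of \<open>S\<close> leaves
  \<open>\<one>\<close>.\<close>

lemma conj_all_retracts_imp_one:
  assumes z: "z \<in> carrier G" "finite S" "rho S z = z"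
    and conj: "\<And>v. v \<in> S \<Longrightarrow> \<exists>s\<in>carrier G. z = s \<otimes> rho (- {v}) z \<otimes> inv s"
  shows "z = \<one>"
proof -
  have "\<exists>s\<in>carrier G. z = s \<otimes> rho (- D) z \<otimes> inv s" if "D \<subseteq> S" for D
    using finite_subset[OF that z(2)] that
  proof (induction D rule: finite_induct)
    case empty
    obtain w where "w \<in> gwords V" "z = cls w" using z(1) by (rule cls_cases)
    then have "rho UNIV z = z" by (simp add: rho_cls)
    then show ?case using z(1) by (intro bexI[of _ \<one>]) simp_all
  next
    case (insert v D)
    obtain s where s: "s \<in> carrier G" "z = s \<otimes> rho (- D) z \<otimes> inv s"
      using insert by blast
    obtain t where t: "t \<in> carrier G" "z = t \<otimes> rho (- {v}) z \<otimes> inv t"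
      using conj insert.prems by blast
    have Dz: "rho (- D) z = rho (- D) t \<otimes> rho (- insert v D) z \<otimes> inv (rho (- D) t)"
    proof -
      have "- D \<inter> - {v} = - insert v D" by blast
      then have "rho (- D) (rho (- {v}) z) = rho (- insert v D) z"
        by (simp only: rho_rho[OF z(1)])
      then have "rho (- D) (t \<otimes> rho (- {v}) z \<otimes> inv t)
          = rho (- D) t \<otimes> rho (- insert v D) z \<otimes> inv (rho (- D) t)"
        using t(1) z(1) by simp
      then show ?thesis using arg_cong[OF t(2), of "rho (- D)"] by (rule HOL.trans[rotated])
    qed
    have "s \<otimes> rho (- D) z \<otimes> inv s
        = (s \<otimes> rho (- D) t) \<otimes> rho (- insert v D) z \<otimes> inv (s \<otimes> rho (- D) t)"
      unfolding Dz using s(1) t(1) z(1) by (simp add: m_assoc inv_mult_group)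
    from HOL.trans[OF s(2) this] show ?case
      using s(1) t(1) by (intro bexI[of _ "s \<otimes> rho (- D) t"]) simp_all
  qed
  from this[of S] obtain s where s: "s \<in> carrier G" "z = s \<otimes> rho (- S) z \<otimes> inv s" by blast
  have "- S \<inter> S = {}" by blast
  then have "rho (- S) (rho S z) = \<one>" by (simp only: rho_rho[OF z(1)] rho_empty[OF z(1)])
  then have "rho (- S) z = \<one>" by (simp only: z(3))
  then have "s \<otimes> rho (- S) z \<otimes> inv s = \<one>" using s(1) by simp
  with s(2) show ?thesis by (rule HOL.trans)
qed

end

section \<open>The action on the Cayley tree attached to a vertex\<close>

locale raag_vertex = raag_group +
  fixes v
  assumes v: "v \<in> V"
begin

abbreviation kappa :: "('a \<times> bool) list set \<Rightarrow> ('a \<times> bool) list set" where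
  "kappa \<equiv> rho (- {v})"

abbreviation gv :: "('a \<times> bool) list set" where
  "gv \<equiv> cls [(v, True)]"

text \<open>The letters of tree words are group elements, standing for the conjugates of
  \<open>gv\<close> that form the basis of the kernel of \<open>kappa\<close>; generators other than
  \<open>v\<close> permute these by conjugation.\<close>

definition act_letter where
  "act_letter a q = (if fst a = v then lmul (gv, snd a) q else relabel (cj (cls [a])) q)"

definition act where
  "act g q = foldr act_letter (SOME w. w \<in> gwords V \<and> g = cls w) q"

lemma letter_closed: "x \<in> V \<Longrightarrow> cls [(x, b)] \<in> carrier G"
  by (rule cls_closed) simp

lemma reduced_act_letter: "fst a \<in> V \<Longrightarrow> reduced q \<Longrightarrow> reduced (act_letter a q)"
  by (cases a) (simp add: act_letter_def reduced_lmul reduced_relabel inj_cj letter_closed)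

lemma reduced_act_word: "w \<in> gwords V \<Longrightarrow> reduced q \<Longrightarrow> reduced (foldr act_letter w q)"
  by (induction w) (auto simp: reduced_act_letter)

lemma relabel_cj_comp:
  "a \<in> carrier G \<Longrightarrow> b \<in> carrier G \<Longrightarrow> relabel (cj a) (relabel (cj b) q) = relabel (cj (a \<otimes> b)) q"
  by (simp add: cj_mult apfst_compose[symmetric])

lemma relabel_id: "relabel id q = q" "relabel (\<lambda>x. x) q = q"
  by (simp_all add: map_idI apfst_def map_prod_def split_def)

lemma act_letter_cancel:
  assumes "x \<in> V" "reduced q"
  shows "act_letter (x, b) (act_letter (x, \<not> b) q) = q"
proof (cases "x = v")
  case True
  then show ?thesis using lmul_flip_lmul(1)[OF assms(2), of "(gv, b)"] by (simp add: act_letter_def)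
next
  case False
  then show ?thesis
    using assms(1) letter_closed[of x b] letter_closed[of x "\<not> b"] cls_inverse_letter[of x b]
    by (simp add: act_letter_def relabel_cj_comp cj_one relabel_id del: map_map)
qed

text \<open>Conjugation by a generator commuting with \<open>v\<close> fixes the letter
  \<open>gv\<close>, so it passes through multiplication by that letter.\<close>

lemma act_letter_commute_v:
  assumes "x \<in> V" "{x, v} \<in> E" "x \<noteq> v"
  shows "act_letter (x, b) (act_letter (v, c) q) = act_letter (v, c) (act_letter (x, b) q)"
proof -
  have "cj (cls [(x, b)]) gv = gv"
    using cls_commute[OF assms(1) v assms(2), of b True] letter_closed[OF v] letter_closed[OF assms(1)]
    by (simp add: cj_def m_assoc)
  then show ?thesis using assms by (simp add: act_letter_def relabel_lmul inj_cj letter_closed)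
qed

lemma act_letter_commute:
  assumes "x \<in> V" "y \<in> V" "{x, y} \<in> E" "reduced q"
  shows "act_letter (x, b) (act_letter (y, c) q) = act_letter (y, c) (act_letter (x, b) q)"
proof (cases "x = v"; cases "y = v")
  \<comment> \<open>Two letters at \<open>v\<close> are equal or inverse to each other.\<close>
  assume "x = v" "y = v"
  then show ?thesis
    using assms(4) lmul_flip_lmul[OF assms(4), of "(gv, b)"] by (cases "c = b") (auto simp: act_letter_def)
next
  assume "x = v" "y \<noteq> v"
  then show ?thesis using act_letter_commute_v[of y c b q] assms by (simp add: insert_commute)
next
  assume "x \<noteq> v" "y = v"
  then show ?thesis using act_letter_commute_v[of x b c q] assms by simp
next
  assume "x \<noteq> v" "y \<noteq> v"
  then show ?thesis using assms cls_commute[OF assms(1-3), of b c]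
    by (simp add: act_letter_def relabel_cj_comp letter_closed del: map_map)
qed

lemma act_word_cong:
  assumes "(u, w) \<in> pres_rel V rels" "reduced q"
  shows "foldr act_letter u q = foldr act_letter w q"
  using assms(1)
proof (induction rule: pres_rel.induct)
  case (cancel u w x b)
  then show ?case using assms(2) by (simp add: act_letter_cancel reduced_act_word)
next
  case (relator u w r)
  obtain x y where r: "r = [(x, True), (y, True), (x, False), (y, False)]" "{x, y} \<in> E"
    using relator by auto
  then have c: "x \<in> V" "y \<in> V" using relator by auto
  define q' where "q' = foldr act_letter w q"
  have q': "reduced q'" using relator assms(2) by (simp add: q'_def reduced_act_word)
  have "act_letter (x, True) (act_letter (y, True) (act_letter (x, False) (act_letter (y, False) q')))
      = act_letter (x, True) (act_letter (x, False) (act_letter (y, True) (act_letter (y, False) q')))"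
    using act_letter_commute[OF c(2,1), of "act_letter (y, False) q'" True False] r(2) c q'
    by (simp add: insert_commute reduced_act_letter)
  also have "\<dots> = q'"
    using act_letter_cancel[of x _ True] act_letter_cancel[of y q' True] c q' by simp
  finally show ?case using r(1) by (simp add: q'_def)
qed simp_all

lemma act_cls:
  assumes "w \<in> gwords V" "reduced q"
  shows "act (cls w) q = foldr act_letter w q"
proof -
  let ?w = "SOME u. u \<in> gwords V \<and> cls w = cls u"
  have "?w \<in> gwords V \<and> cls w = cls ?w" by (rule someI) (use assms in blast)
  then have "(w, ?w) \<in> pres_rel V rels" by (intro cls_eqD) auto
  then show ?thesis unfolding act_def by (rule act_word_cong[OF _ assms(2), symmetric])
qed

lemma reduced_act:
  assumes "g \<in> carrier G" "reduced q"
  shows "reduced (act g q)"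
proof -
  obtain w where w: "w \<in> gwords V" "g = cls w" using assms(1) by (rule cls_cases)
  then show ?thesis using assms(2) by (simp add: act_cls reduced_act_word)
qed

lemma act_mult:
  assumes "g \<in> carrier G" "h \<in> carrier G" "reduced q"
  shows "act (g \<otimes> h) q = act g (act h q)"
proof -
  obtain u where u: "u \<in> gwords V" "g = cls u" using assms(1) by (rule cls_cases)
  obtain w where w: "w \<in> gwords V" "h = cls w" using assms(2) by (rule cls_cases)
  have "act (cls (u @ w)) q = act (cls u) (act (cls w) q)"
    using u(1) w(1) assms(3) by (simp add: act_cls reduced_act_word)
  then show ?thesis by (simp only: u(2) w(2) cls_append[OF u(1) w(1)])
qed

lemma act_one [simp]: "reduced q \<Longrightarrow> act \<one> q = q"
  using act_cls[of "[]" q] by (simp add: cls_Nil)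

lemma act_inv_cancel [simp]:
  assumes "g \<in> carrier G" "reduced q"
  shows "act (inv g) (act g q) = q" "act g (act (inv g) q) = q"
  using act_mult[of "inv g" g q] act_mult[of g "inv g" q] assms by simp_all

lemma act_step:
  assumes "x \<in> V" "h \<in> carrier G" "reduced q"
  shows "act (cls [(x, b)] \<otimes> h) q = act_letter (x, b) (act h q)"
  using assms by (simp add: act_mult letter_closed act_cls reduced_act)

definition verts where
  "verts = {q. reduced q \<and> fst ` set q \<subseteq> carrier G}"

lemma verts_Nil [simp]: "[] \<in> verts"
  by (simp add: verts_def)

lemma vertsD: "q \<in> verts \<Longrightarrow> reduced q" "q \<in> verts \<Longrightarrow> fst ` set q \<subseteq> carrier G"
  by (auto simp: verts_def)

lemma set_lmul: "set (lmul a q) \<subseteq> insert a (set q)"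
  by (cases q) (auto simp: lmul_def)

lemma verts_act_letter:
  assumes "fst a \<in> V" "q \<in> verts"
  shows "act_letter a q \<in> verts"
proof (cases "fst a = v")
  case True
  have "fst ` set (lmul (gv, snd a) q) \<subseteq> fst ` insert (gv, snd a) (set q)"
    by (intro image_mono set_lmul)
  also have "\<dots> \<subseteq> carrier G"
    using letter_closed[OF v, of True] vertsD(2)[OF assms(2)] by simp
  finally show ?thesis using assms(2) True
    by (simp add: verts_def act_letter_def reduced_lmul)
next
  case False
  then show ?thesis using assms letter_closed[of "fst a" "snd a"]
    by (auto simp: verts_def act_letter_def reduced_relabel inj_cj cj_closed)
qed

lemma verts_act: "g \<in> carrier G \<Longrightarrow> q \<in> verts \<Longrightarrow> act g q \<in> verts"
proof (induction g rule: letter_induct)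
  case one
  then show ?case by (simp add: vertsD)
next
  case (letter x b h)
  then show ?case by (simp add: act_step vertsD verts_act_letter)
qed

text \<open>Evaluation carries the tree action to
  \<open>x \<mapsto> g \<otimes> x \<otimes> inv (kappa g)\<close>: this is left multiplication for
  \<open>v\<close>, which \<open>kappa\<close> kills, and conjugation for the other generators,
  which \<open>kappa\<close> fixes.\<close>

lemma eps_act:
  assumes "g \<in> carrier G" and q: "q \<in> verts"
  shows "eps (act g q) = g \<otimes> eps q \<otimes> inv (kappa g)"
  using assms(1)
proof (induction g rule: letter_induct)
  case one
  then show ?case using q by (simp add: vertsD eps_closed)
next
  case (letter x b h)
  have c: "act h q \<in> verts" "eps q \<in> carrier G"
    using letter q verts_act by (auto simp: vertsD eps_closed)
  have lc: "cls [(x, b)] \<in> carrier G" using letter by (simp add: letter_closed)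
  show ?case
  proof (cases "x = v")
    case True
    have "(if b then gv else inv gv) = cls [(v, b)]"
      using cls_inverse_letter[OF v, of True] by (cases b) simp_all
    moreover have "eps (lmul (gv, b) (act h q)) = (if b then gv else inv gv) \<otimes> eps (act h q)"
      using eps_lmul[of "(gv, b)" "act h q"] c vertsD(2) letter_closed[OF v] by simp
    ultimately have "eps (act_letter (x, b) (act h q)) = cls [(x, b)] \<otimes> eps (act h q)"
      using True by (simp add: act_letter_def)
    then show ?thesis using letter c lc q True
      by (simp add: act_step vertsD rho_letter m_assoc)
  next
    case False
    then have "eps (act_letter (x, b) (act h q)) = cls [(x, b)] \<otimes> eps (act h q) \<otimes> inv cls [(x, b)]"
      using eps_relabel[OF lc, of "act h q"] c vertsD by (simp add: act_letter_def)
    then show ?thesis using letter c lc q False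
      by (simp add: act_step vertsD rho_letter m_assoc inv_mult_group)
  qed
qed

text \<open>Every element acts as a twisted translation, which brings in
  \<open>twisted_fixed_vertex\<close> and \<open>starts_iff_fmul\<close>.\<close>

lemma act_fmul:
  assumes "g \<in> carrier G" and q: "reduced q"
  shows "act g q = fmul (act g []) (relabel (cj (kappa g)) q)"
  using assms(1)
proof (induction g rule: letter_induct)
  case one
  then show ?case using q by (simp add: cj_one relabel_id)
next
  case (letter x b h)
  have lc: "cls [(x, b)] \<in> carrier G" using letter by (simp add: letter_closed)
  show ?case
  proof (cases "x = v")
    case True
    then show ?thesis using letter lc q
      by (simp add: act_step act_letter_def rho_letter fmul_lmul reduced_relabel inj_cj)
  next
    case False
    then show ?thesis using letter lc q
      by (simp add: act_step act_letter_def rho_letter relabel_fmul inj_cj relabel_cj_comp del: map_map)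
  qed
qed

lemma act_kernel: "g \<in> carrier G \<Longrightarrow> kappa g = \<one> \<Longrightarrow> reduced q \<Longrightarrow> act g q = fmul (act g []) q"
  using act_fmul[of g q] by (simp add: cj_one relabel_id)

text \<open>Solve \<open>eps_act\<close> at the fixed vertex for \<open>g\<close>. In particular the
  kernel of \<open>kappa\<close> acts freely.\<close>

lemma fixed_vertex_conj:
  assumes "g \<in> carrier G" "q \<in> verts" "act g q = q"
  shows "g = eps q \<otimes> kappa g \<otimes> inv (eps q)"
proof -
  have e: "eps q \<in> carrier G" using assms by (simp add: vertsD eps_closed)
  have eq: "g \<otimes> eps q \<otimes> inv (kappa g) = eps q" using eps_act[OF assms(1,2)] assms(3) by simp
  have "g = g \<otimes> eps q \<otimes> inv (kappa g) \<otimes> (kappa g \<otimes> inv (eps q))"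
  proof -
    have "inv (kappa g) \<otimes> (kappa g \<otimes> inv (eps q)) = inv (eps q)"
      using assms(1) e by (simp add: m_assoc[symmetric])
    then show ?thesis using assms(1) e by (simp add: m_assoc)
  qed
  also have "\<dots> = eps q \<otimes> kappa g \<otimes> inv (eps q)"
    unfolding eq using assms(1) e by (simp add: m_assoc)
  finally show ?thesis .
qed

lemma kernel_free:
  assumes "g \<in> carrier G" "kappa g = \<one>" "q \<in> verts" "act g q = q"
  shows "g = \<one>"
  using fixed_vertex_conj[OF assms(1,3,4)] assms(2,3)
  by (simp only: r_one eps_closed[OF vertsD(2)] r_inv)

lemma act_kappa_root: "g \<in> carrier G \<Longrightarrow> act (kappa g) [] = []"
proof (induction g rule: letter_induct)
  case (letter x b h)
  then show ?case by (simp add: rho_letter letter_closed act_step act_letter_def)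
qed simp

section \<open>The orbit of the root and cyclic reduction\<close>

lemma orbit_letter:
  assumes "g \<in> carrier G" "a \<in> set (act g [])"
  shows "\<exists>h\<in>carrier G. fst a = kappa h \<otimes> gv \<otimes> inv (kappa h)"
  using assms
proof (induction g arbitrary: a rule: letter_induct)
  case (letter x b g)
  show ?case
  proof (cases "x = v")
    case True
    then have "a \<in> insert (gv, b) (set (act g []))"
      using letter set_lmul[of "(gv, b)" "act g []"] by (auto simp: act_step act_letter_def)
    moreover have "fst (gv, b) = kappa \<one> \<otimes> gv \<otimes> inv (kappa \<one>)"
      using letter_closed[OF v] by simp
    ultimately show ?thesis using letter.IH by blast
  next
    case False
    then obtain a' where a': "a' \<in> set (act g [])" "a = apfst (cj (cls [(x, b)])) a'"
      using letter by (auto simp: act_step act_letter_def)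
    then obtain h where h: "h \<in> carrier G" "fst a' = kappa h \<otimes> gv \<otimes> inv (kappa h)"
      using letter.IH by blast
    have "fst a = kappa (cls [(x, b)] \<otimes> h) \<otimes> gv \<otimes> inv (kappa (cls [(x, b)] \<otimes> h))"
      using a' h False letter_closed[OF v, of True] letter_closed[OF letter(1), of b] letter(1)
      by (simp add: cj_def rho_letter m_assoc inv_mult_group)
    then show ?thesis using h(1) letter_closed[OF letter(1), of b] by blast
  qed
qed simp

text \<open>By \<open>orbit_letter\<close> the letter is a conjugate of \<open>gv\<close> by some
  \<open>kappa h\<close>, which fixes the root; so \<open>kappa h\<close> times a power of
  \<open>v\<close> moves the root to it.\<close>

lemma orbit_neighbour:
  assumes "g \<in> carrier G" "a \<in> set (act g [])"
  shows "\<exists>k\<in>carrier G. act k [] = [a]"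
proof -
  obtain h where h: "h \<in> carrier G" "fst a = kappa h \<otimes> gv \<otimes> inv (kappa h)"
    using orbit_letter[OF assms] by blast
  let ?x = "cls [(v, snd a)]"
  have x: "?x \<in> carrier G" using letter_closed[OF v] .
  have "act ?x [] = [(gv, snd a)]"
    using act_cls[of "[(v, snd a)]" "[]"] v by (simp add: act_letter_def lmul_def)
  then have "act (kappa h \<otimes> ?x) [] = act (kappa h) [(gv, snd a)]"
    using act_mult[of "kappa h" ?x "[]"] h(1) x by simp
  also have "\<dots> = relabel (cj (kappa h)) [(gv, snd a)]"
    using act_fmul[of "kappa h" "[(gv, snd a)]"] h(1) by (simp add: act_kappa_root rho_rho)
  also have "\<dots> = [(fst a, snd a)]"
    unfolding h(2) using letter_closed[OF v, of True] by (simp add: cj_def)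
  finally have "act (kappa h \<otimes> ?x) [] = [a]" by simp
  moreover have "kappa h \<otimes> ?x \<in> carrier G" using h(1) x by simp
  ultimately show ?thesis by blast
qed

text \<open>Choose \<open>k\<close> minimizing the distance by which the conjugate moves the root.
  If the word still started with \<open>l\<close> and ended with its inverse, conjugating by an
  \<open>h\<close> that moves the root to \<open>[l]\<close> would strip both letters.\<close>

lemma cyclically_reduced_conjugate:
  assumes g: "g \<in> carrier G" "kappa g = \<one>" "g \<noteq> \<one>"
  obtains k where "k \<in> carrier G" "act (inv k \<otimes> g \<otimes> k) [] \<noteq> []"
    "last (act (inv k \<otimes> g \<otimes> k) []) \<noteq> flip (hd (act (inv k \<otimes> g \<otimes> k) []))"
proof -
  define W where "W k = act (inv k \<otimes> g \<otimes> k) []" for k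
  obtain k where k: "k \<in> carrier G" and least: "\<And>h. h \<in> carrier G \<Longrightarrow> length (W k) \<le> length (W h)"
    using ex_has_least_nat[of "\<lambda>k. k \<in> carrier G" \<one> "length \<circ> W"] by auto
  define g' where "g' = inv k \<otimes> g \<otimes> k"
  have g': "g' \<in> carrier G" "kappa g' = \<one>" using g k by (simp_all add: g'_def)
  have "g' \<noteq> \<one>"
  proof
    assume "g' = \<one>"
    then have "k \<otimes> g' \<otimes> inv k = \<one>" using k by simp
    then show False using g k by (simp add: g'_def m_assoc inv_solve_left')
      (simp add: m_assoc[symmetric])
  qed
  then have ne: "W k \<noteq> []"
    using kernel_free[OF g' verts_Nil] by (auto simp: W_def g'_def)
  have "last (W k) \<noteq> flip (hd (W k))"
  proof
    assume last: "last (W k) = flip (hd (W k))"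
    obtain l r where lr: "W k = l # r" using ne by (cases "W k") auto
    then have "r \<noteq> []" "last r = flip l" using last by (auto split: if_splits)
    then obtain r' where r': "r = r' @ [flip l]" by (metis append_butlast_last_id)
    have red: "reduced (W k)" using g' reduced_act by (simp add: W_def g'_def)
    obtain h where h: "h \<in> carrier G" "act h [] = [l]"
      using orbit_neighbour[of g' l] g' lr by (auto simp: W_def g'_def)
    define s where "s = relabel (cj (inv (kappa h))) r'"
    have r'red: "reduced r'" "reduced (l # r')"
      using red lr r' by (auto simp: successively_Cons successively_append_iff)
    have "relabel (cj (kappa h)) s = r'"
      using h(1) by (simp add: s_def relabel_cj_comp cj_one relabel_id del: map_map)
    moreover have sr: "reduced s" using r'red h(1) by (simp add: s_def reduced_relabel inj_cj)
    ultimately have hs: "act h s = l # r'"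
      using act_fmul[OF h(1) sr] h(2) fmul_reduced_append[of "[l]" r'] r'red by simp
    have "act g' [l] = fmul (W k) [l]"
      using act_kernel[OF g', of "[l]"] by (simp add: W_def g'_def)
    also have "\<dots> = fmul (l # r') []"
      using lr r' by (simp add: lmul_def)
    also have "\<dots> = l # r'" using fmul_Nil r'red by blast
    finally have "act (inv h) (act g' (act h [])) = s"
      using h hs act_inv_cancel(1)[OF h(1) sr] by simp
    then have "W (k \<otimes> h) = s"
      using h g' g k unfolding W_def g'_def
      by (simp add: inv_mult_group m_assoc act_mult reduced_act)
    then show False using least[of "k \<otimes> h"] k h(1) lr r' by (simp add: s_def)
  qed
  with that k ne show ?thesis by (simp add: W_def)
qed

end

text \<open>The condition on \<open>w\<close> puts the root on the axis of \<open>g\<close>: powers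
  of \<open>w\<close> have no cancellation.\<close>

locale cyclically_reduced = raag_vertex +
  fixes g w
  assumes g: "g \<in> carrier G" "kappa g = \<one>" and w: "w = act g []" "w \<noteq> []" "last w \<noteq> flip (hd w)"
begin

lemma reduced_w: "reduced w"
  using g w by (simp add: reduced_act)

lemma act_g_append:
  assumes "reduced q" "q = [] \<or> hd q = hd w"
  shows "act g q = w @ q"
proof -
  have "reduced (w @ q)" using assms reduced_w w
    by (auto simp: successively_append_iff dest: arg_cong[of _ _ flip])
  then show ?thesis using act_kernel[OF g assms(1)] w(1) fmul_reduced_append by simp
qed

lemma act_pow: "act (g [^] (n::nat)) [] = concat (replicate n w)"
proof (induction n)
  case (Suc n)
  have "g [^] Suc n = g \<otimes> g [^] n" by (rule nat_pow_Suc2[OF g(1)])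
  then have "act (g [^] Suc n) [] = act g (concat (replicate n w))"
    using Suc g by (simp add: act_mult del: nat_pow_Suc)
  also have "\<dots> = w @ concat (replicate n w)"
  proof (rule act_g_append)
    show "reduced (concat (replicate n w))" using Suc reduced_act[of "g [^] n" "[]"] g by simp
    show "concat (replicate n w) = [] \<or> hd (concat (replicate n w)) = hd w"
      using w(2) by (cases n) simp_all
  qed
  finally show ?case by simp
qed simp

end

section \<open>No nontrivial element is conjugate to its inverse\<close>

context raag_vertex
begin

text \<open>After cyclic reduction, all \<open>y n\<close> have the same square. One of them fixes a
  vertex, since otherwise they would move the root by a bounded amount while the powers of
  \<open>g'\<close> do not.\<close>

lemma invert_imp_square_conj:
  assumes g: "g \<in> carrier G" "kappa g = \<one>" "g \<noteq> \<one>" and h: "h \<in> carrier G"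
    and inverts: "h \<otimes> g \<otimes> inv h = inv g"
  shows "\<exists>s\<in>carrier G. h \<otimes> h = s \<otimes> kappa (h \<otimes> h) \<otimes> inv s"
proof -
  obtain k where k: "k \<in> carrier G" and
    w: "act (inv k \<otimes> g \<otimes> k) [] \<noteq> []"
    "last (act (inv k \<otimes> g \<otimes> k) []) \<noteq> flip (hd (act (inv k \<otimes> g \<otimes> k) []))"
    using cyclically_reduced_conjugate[OF g] .
  define g' where "g' = inv k \<otimes> g \<otimes> k"
  define h' where "h' = inv k \<otimes> h \<otimes> k"
  have g'c: "g' \<in> carrier G" and kg': "kappa g' = \<one>"
    using g k by (simp_all add: g'_def)
  interpret cyclically_reduced G V E v g' "act g' []"
    by unfold_locales (use g k w in \<open>simp_all add: g'_def\<close>)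
  have h': "h' \<in> carrier G" using h k by (simp add: h'_def)
  have kk: "k \<otimes> (inv k \<otimes> x) = x" if "x \<in> carrier G" for x
    using k that by (simp add: m_assoc[symmetric])
  have "h' \<otimes> g' \<otimes> inv h' = inv k \<otimes> (h \<otimes> g \<otimes> inv h) \<otimes> k"
    using assms(1) h k by (simp add: g'_def h'_def inv_mult_group m_assoc kk)
  also have "\<dots> = inv g'"
    using assms(1) k unfolding inverts g'_def by (simp add: inv_mult_group m_assoc)
  finally have "h' \<otimes> g' \<otimes> inv h' \<otimes> h' = inv g' \<otimes> h'" by simp
  then have inv': "h' \<otimes> g' = inv g' \<otimes> h'" using h' g'c by (simp add: m_assoc)
  define y where "y n = g' [^] (n::nat) \<otimes> h'" for n
  have y: "y n \<in> carrier G" for n using g'c h' by (simp add: y_def)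
  have hp: "h' \<otimes> g' [^] n \<otimes> x = inv (g' [^] n) \<otimes> (h' \<otimes> x)" if "x \<in> carrier G" for n :: nat and x
    using that
  proof (induction n arbitrary: x)
    case (Suc n)
    have "h' \<otimes> g' [^] Suc n \<otimes> x = h' \<otimes> g' [^] n \<otimes> (g' \<otimes> x)"
      using Suc h' g'c by (simp add: m_assoc)
    also have "\<dots> = inv (g' [^] n) \<otimes> (h' \<otimes> g' \<otimes> x)"
      using Suc h' g'c by (simp add: m_assoc)
    also have "\<dots> = inv (g' [^] n) \<otimes> inv g' \<otimes> (h' \<otimes> x)"
      using Suc h' g'c unfolding inv' by (simp add: m_assoc)
    also have "inv (g' [^] n) \<otimes> inv g' = inv (g' [^] Suc n)"
      using g'c nat_pow_Suc2[of g' n] by (simp only: inv_mult_group nat_pow_closed)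
    finally show ?case .
  qed (use h' in simp)
  have yy: "y n \<otimes> y n = h' \<otimes> h'" for n
    using hp[of h' n] h' g'c
    by (simp add: y_def m_assoc) (simp add: m_assoc[symmetric])
  have ky: "kappa (y n) = kappa h'" for n
    using g'c h' kg' by (simp add: y_def)
  have "\<exists>n. \<exists>q\<in>verts. act (y n) q = q"
  proof (rule ccontr)
    assume no_fix: "\<not> ?thesis"
    \<comment> \<open>Otherwise \<open>y n\<close> moves the root farther than its square does, and
      \<open>twisted_fixed_vertex\<close> yields a fixed prefix.\<close>
    have short: "length (act (y n) []) \<le> length (act (h' \<otimes> h') [])" for n
    proof (rule ccontr)
      define c where "c = act (y n) []"
      have c: "c \<in> verts" using y by (simp add: c_def verts_act)
      have inj: "inj (cj (kappa (y n)))" using y by (simp add: inj_cj)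
      have act_y: "act (y n) q = fmul c (relabel (cj (kappa (y n))) q)" if "reduced q" for q
        using act_fmul[OF y that] by (simp add: c_def)
      assume "\<not> length (act (y n) []) \<le> length (act (h' \<otimes> h') [])"
      moreover have "act (h' \<otimes> h') [] = act (y n) c"
        using act_mult[OF y y, of "[]" n n] by (simp add: c_def yy)
      ultimately have "length (act (y n) c) < length c"
        by (simp only: not_le c_def[symmetric])
      then have "length (fmul c (relabel (cj (kappa (y n))) c)) < length c"
        by (simp only: act_y[OF vertsD(1)[OF c]])
      then obtain j where "fmul c (relabel (cj (kappa (y n))) (take j c)) = take j c"
        using twisted_fixed_vertex[OF vertsD(1)[OF c] inj] by blast
      moreover have t: "take j c \<in> verts"
      proof -
        have "reduced (take j c @ drop j c)" using vertsD(1)[OF c] by simp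
        then have "reduced (take j c)" by (simp only: successively_append_iff)
        moreover have "fst ` set (take j c) \<subseteq> carrier G"
          using vertsD(2)[OF c] set_take_subset[of j c] by blast
        ultimately show ?thesis by (simp add: verts_def)
      qed
      ultimately have "act (y n) (take j c) = take j c"
        by (simp only: act_y[OF vertsD(1)[OF t]])
      with t no_fix show False by blast
    qed
    \<comment> \<open>A bound for all powers of \<open>g'\<close>, as
      \<open>g' [^] n = y n \<otimes> inv h'\<close>; the exponent \<open>Suc m\<close> exceeds
      it.\<close>
    define m where "m = length (act (h' \<otimes> h') []) + length (act (inv h') [])"
    have "length (concat (replicate n (act g' []))) \<le> m" for n
    proof -
      have "g' [^] n = y n \<otimes> inv h'" using h' g'c by (simp add: y_def m_assoc)
      then have "act (g' [^] n) [] = act (y n) (act (inv h') [])"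
        using act_mult[of "y n" "inv h'" "[]"] y h' by simp
      also have "\<dots> = fmul (act (y n) []) (relabel (cj (kappa (y n))) (act (inv h') []))"
        by (rule act_fmul[OF y reduced_act]) (use h' in simp_all)
      finally have "length (act (g' [^] n) []) \<le> length (act (y n) []) + length (act (inv h') [])"
        using length_fmul_le[of "act (y n) []" "relabel (cj (kappa (y n))) (act (inv h') [])"]
        by simp
      then show ?thesis using short[of n] act_pow[of n] by (simp add: m_def)
    qed
    from this[of "Suc m"] have "Suc m * length (act g' []) \<le> m"
      by (simp add: length_concat sum_list_replicate)
    moreover have "length (act g' []) \<ge> 1" using w by (cases "act g' []") (auto simp: g'_def)
    ultimately show False using mult_le_mono2[of 1 "length (act g' [])" "Suc m"] by simp
  qed
  then obtain n q where q: "q \<in> verts" "act (y n) q = q" by blast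
  have e: "eps q \<in> carrier G" using q(1) by (simp add: vertsD eps_closed)
  have yq: "y n = eps q \<otimes> kappa h' \<otimes> inv (eps q)"
    using fixed_vertex_conj[OF y q] unfolding ky .
  have ee: "inv (eps q) \<otimes> (eps q \<otimes> x) = x" if "x \<in> carrier G" for x
    using e that by (simp add: m_assoc[symmetric])
  have "h' \<otimes> h' = (eps q \<otimes> kappa h' \<otimes> inv (eps q)) \<otimes> (eps q \<otimes> kappa h' \<otimes> inv (eps q))"
    using yy[of n] by (simp only: yq)
  also have "\<dots> = eps q \<otimes> (kappa h' \<otimes> kappa h') \<otimes> inv (eps q)"
    using e h' by (simp add: m_assoc ee)
  finally have h'2: "h' \<otimes> h' = eps q \<otimes> (kappa h' \<otimes> kappa h') \<otimes> inv (eps q)" .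
  \<comment> \<open>Undoing the conjugation by \<open>k\<close> also conjugates
    \<open>kappa h'\<close> by \<open>kappa k\<close>, whence the last factor.\<close>
  define s where "s = k \<otimes> eps q \<otimes> inv (kappa k)"
  have rk: "kappa k \<otimes> (inv (kappa k) \<otimes> x) = x" if "x \<in> carrier G" for x
    using k that by (simp add: m_assoc[symmetric])
  have "h \<otimes> h = k \<otimes> (h' \<otimes> h') \<otimes> inv k"
    using h k by (simp add: h'_def m_assoc kk)
  also have "\<dots> = s \<otimes> kappa (h \<otimes> h) \<otimes> inv s"
    unfolding h'2 using h k e by (simp add: h'_def s_def m_assoc inv_mult_group rk)
  finally show ?thesis using k e by (intro bexI[of _ s]) (simp_all add: s_def)
qed

end

context raag_group
begin

lemma vertex_locale: "x \<in> V \<Longrightarrow> raag_vertex G V E x"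
  by unfold_locales

text \<open>A cyclically reduced conjugate of a retract onto a minimal support moves the root to a
  nonempty \<open>w\<close>, and its square moves it to \<open>w @ w\<close>.\<close>

lemma square_eq_one_imp_one:
  assumes z: "z \<in> carrier G" "z \<otimes> z = \<one>"
  shows "z = \<one>"
proof (rule ccontr)
  assume "z \<noteq> \<one>"
  obtain S where S: "finite S" "S \<subseteq> V" "S \<noteq> {}" "rho S z \<noteq> \<one>"
    "\<forall>v\<in>S. rho (- {v}) (rho S z) = \<one>"
    using minimal_support[OF z(1) \<open>z \<noteq> \<one>\<close>] .
  then obtain v where vS: "v \<in> S" "v \<in> V" by blast
  interpret raag_vertex G V E v using vS(2) by (rule vertex_locale)
  let ?z = "rho S z"
  have zc: "?z \<in> carrier G" using z(1) by simp
  obtain k where k: "k \<in> carrier G" and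
    w: "act (inv k \<otimes> ?z \<otimes> k) [] \<noteq> []"
    "last (act (inv k \<otimes> ?z \<otimes> k) []) \<noteq> flip (hd (act (inv k \<otimes> ?z \<otimes> k) []))"
    using cyclically_reduced_conjugate[OF zc bspec[OF S(5) vS(1)] S(4)] .
  define g' where "g' = inv k \<otimes> ?z \<otimes> k"
  have g'c: "g' \<in> carrier G" using zc k by (simp add: g'_def)
  interpret cyclically_reduced G V E v g' "act g' []"
    by unfold_locales (use zc k w bspec[OF S(5) vS(1)] in \<open>simp_all add: g'_def\<close>)
  have kk: "k \<otimes> (inv k \<otimes> x) = x" if "x \<in> carrier G" for x
    using k that by (simp add: m_assoc[symmetric])
  have "?z \<otimes> ?z = \<one>" using arg_cong[OF z(2), of "rho S"] z(1) by simp
  then have "?z \<otimes> (?z \<otimes> k) = k" using zc k by (simp add: m_assoc[symmetric])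
  then have "g' \<otimes> g' = \<one>" using zc k by (simp add: g'_def m_assoc kk)
  then have "g' [^] (2::nat) = \<one>" using g'c by (simp add: numeral_2_eq_2)
  then show False using act_pow[of 2] w by (simp add: g'_def numeral_2_eq_2)
qed

text \<open>On a minimal support of \<open>g\<close>, \<open>invert_imp_square_conj\<close> holds at
  every vertex, so the retract of \<open>h\<close> has trivial square and is trivial; then the
  retract of \<open>g\<close> is its own inverse.\<close>

lemma no_conj_inverse:
  assumes g: "g \<in> carrier G" "g \<noteq> \<one>" and h: "h \<in> carrier G"
  shows "h \<otimes> g \<otimes> inv h \<noteq> inv g"
proof
  assume inverts: "h \<otimes> g \<otimes> inv h = inv g"
  obtain S where S: "finite S" "S \<subseteq> V" "S \<noteq> {}" "rho S g \<noteq> \<one>"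
    "\<forall>v\<in>S. rho (- {v}) (rho S g) = \<one>"
    using minimal_support[OF g] .
  define g' h' where "g' = rho S g" and "h' = rho S h"
  have c: "g' \<in> carrier G" "h' \<in> carrier G" using g h by (simp_all add: g'_def h'_def)
  have inv': "h' \<otimes> g' \<otimes> inv h' = inv g'"
    using arg_cong[OF inverts, of "rho S"] g h by (simp add: g'_def h'_def)
  have "h' \<otimes> h' = \<one>"
  proof (rule conj_all_retracts_imp_one[OF _ S(1)])
    fix v assume vS: "v \<in> S"
    interpret raag_vertex G V E v using S(2) vS by (intro vertex_locale) auto
    show "\<exists>s\<in>carrier G. h' \<otimes> h' = s \<otimes> rho (- {v}) (h' \<otimes> h') \<otimes> inv s"
      using invert_imp_square_conj[OF c(1) _ _ c(2) inv'] S(4) bspec[OF S(5) vS] by (simp add: g'_def)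
  qed (use c h in \<open>simp_all add: h'_def rho_rho\<close>)
  then have "h' = \<one>" using square_eq_one_imp_one c(2) by blast
  then have "g' = inv g'" using inv' c(1) by simp
  then have "g' \<otimes> g' = \<one>" using c(1) by (metis r_inv)
  then show False using square_eq_one_imp_one[OF c(1)] S(4) by (simp add: g'_def)
qed

end

section \<open>The cut system given by a half-tree\<close>

context cyclically_reduced
begin

text \<open>The half-tree of words starting like \<open>w\<close>, pulled back to the group along
  the orbit map of the root.\<close>

definition cone where
  "cone = {z \<in> carrier G. prefix [hd w] (act z [])}"

lemma nested_cut_cone: "nested_cut G cone g"
proof
  show "cone \<subseteq> carrier G" by (auto simp: cone_def)
  have hd_prefix: "prefix [hd w] (w @ q)" for q using w(2) by (cases w) simp_all
  then have "prefix [hd w] w" using append_Nil2 by metis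
  then show "g \<in> cone" using g(1) by (simp add: cone_def w(1)[symmetric])
  show "\<one> \<notin> cone" by (simp add: cone_def)
  fix x assume x: "x \<in> cone"
  then have xc: "x \<in> carrier G" by (simp add: cone_def)
  have "act x [] \<noteq> [] \<and> hd (act x []) = hd w" using x by (auto simp: cone_def prefix_def)
  then have "act (g \<otimes> x) [] = w @ act x []"
    using act_mult[OF g(1) xc] act_g_append[of "act x []"] xc by (simp add: reduced_act)
  then show "g \<otimes> x \<in> cone" using g(1) xc hd_prefix by (simp add: cone_def)
qed

sublocale nested_cut G cone g
  by (rule nested_cut_cone)

text \<open>The action of \<open>k\<close> is a twisted translation, so
  \<open>starts_iff_fmul\<close> applies with the first letter of \<open>w\<close> relabelled to
  \<open>l\<close>.\<close>

lemma tr_iff: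
  assumes k: "k \<in> carrier G" and z: "z \<in> carrier G"
  defines "u \<equiv> act k []" and "l \<equiv> apfst (cj (kappa k)) (hd w)"
  shows "z \<in> tr k \<longleftrightarrow>
    (if u \<noteq> [] \<and> last u = flip l then \<not> prefix u (act z []) else prefix (u @ [l]) (act z []))"
proof -
  define q where "q = act (inv k \<otimes> z) []"
  have q: "reduced q" using k z by (simp add: q_def reduced_act)
  have inj: "inj (cj (kappa k))" using k by (simp add: inj_cj)
  have "act k q = act z []"
    using act_mult[of "inv k" z "[]"] k z by (simp add: q_def reduced_act)
  then have az: "act z [] = fmul u (relabel (cj (kappa k)) q)"
    using act_fmul[OF k q] by (simp add: u_def)
  have "z \<in> tr k \<longleftrightarrow> prefix [hd w] q" using k z unfolding tr_def by (simp add: cone_def q_def)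
  also have "\<dots> \<longleftrightarrow> prefix [l] (relabel (cj (kappa k)) q)"
    using inj by (cases q) (auto simp: l_def apfst_inject)
  finally show ?thesis
    unfolding az
    using starts_iff_fmul[of u "relabel (cj (kappa k)) q" l] k q inj
    by (simp add: u_def reduced_act reduced_relabel)
qed

lemma tr_cylinder:
  assumes k: "k \<in> carrier G"
  obtains u where "u \<noteq> []" "tr k = {z \<in> carrier G. prefix u (act z [])}"
  | u where "u \<noteq> []" "tr k = {z \<in> carrier G. \<not> prefix u (act z [])}"
proof -
  have sub: "tr k \<subseteq> carrier G" by (auto simp: tr_def)
  show ?thesis
  proof (cases "act k [] \<noteq> [] \<and> last (act k []) = flip (apfst (cj (kappa k)) (hd w))")
    case True
    then have "tr k = {z \<in> carrier G. \<not> prefix (act k []) (act z [])}"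
      using tr_iff[OF k] sub by auto
    then show ?thesis using that(2)[of "act k []"] True by blast
  next
    case False
    then have "tr k = {z \<in> carrier G. prefix (act k [] @ [apfst (cj (kappa k)) (hd w)]) (act z [])}"
      using tr_iff[OF k] sub by auto
    then show ?thesis using that(1) by blast
  qed
qed

text \<open>A translate of the pair \<open>cone \<supset> g cone\<close> occurring backwards along the axis of \<open>g\<close> moves
  the root by the translation length of \<open>g\<close>, so that \<open>k\<inverse> g k g\<close> fixes the root and is trivial.\<close>

lemma reverse_copy_imp_conj_inverse:
  assumes k: "k \<in> carrier G" and copy: "g [^] (n::nat) \<notin> tr k" "\<one> \<in> tr (k \<otimes> g)"
  shows "inv k \<otimes> g \<otimes> k = inv g"
proof -
  define u u' where "u = act k []" and "u' = act (k \<otimes> g) []"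
  have kg: "k \<otimes> g \<in> carrier G" using k g by simp
  have sub: "tr (k \<otimes> g) \<subseteq> tr k" using tr_shift_less[OF k] by blast
  have gn: "g [^] n \<in> carrier G" "act (g [^] n) [] = concat (replicate n w)"
    using g act_pow by simp_all
  \<comment> \<open>\<open>\<one>\<close> lies in \<open>tr (k \<otimes> g)\<close> and so in
    \<open>tr k\<close>. The empty word lies in no cylinder of a nonempty word, so both translates
    are complements.\<close>
  have tr1: "z \<in> tr k \<longleftrightarrow> \<not> prefix u (act z [])" if "z \<in> carrier G" for z
    using tr_iff[OF k that] tr_iff[OF k, of \<one>] copy(2) sub by (auto simp: u_def split: if_splits)
  have tr2: "z \<in> tr (k \<otimes> g) \<longleftrightarrow> \<not> prefix u' (act z [])" if "z \<in> carrier G" for z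
    using tr_iff[OF kg that] tr_iff[OF kg, of \<one>] copy(2) by (auto simp: u'_def split: if_splits)
  have pu: "prefix u (concat (replicate n w))" using tr1[OF gn(1)] copy(1) gn(2) by simp
  have "k \<notin> tr (k \<otimes> g)" using tr1[OF k] sub by (auto simp: u_def)
  then have "prefix u' u" using tr2[OF k] by (simp add: u_def)
  then obtain r where r: "u = u' @ r" by (auto simp: prefix_def)
  have ur: "reduced u" using k by (simp add: u_def reduced_act)
  \<comment> \<open>Comparing \<open>u = u' @ r\<close> with \<open>u'\<close> as \<open>u\<close>
    times the relabelled \<open>w\<close> shows that \<open>r\<close> is the inverse of the
    relabelled \<open>w\<close>, hence as long as \<open>w\<close>.\<close>
  have "u' = act k w" using act_mult[OF k g(1), of "[]"] w(1) by (simp add: u'_def)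
  also have "\<dots> = fmul u (relabel (cj (kappa k)) w)"
    using act_fmul[OF k reduced_w] by (simp add: u_def)
  finally have "fmul u' (fmul r (relabel (cj (kappa k)) w)) = u'" using r by simp
  moreover have sw: "reduced (relabel (cj (kappa k)) w)"
    using reduced_w k by (simp add: reduced_relabel inj_cj)
  moreover have "reduced u'" using ur r by (simp add: successively_append_iff)
  ultimately have "fmul r (relabel (cj (kappa k)) w) = []"
    using fmul_inject[of "fmul r (relabel (cj (kappa k)) w)" "[]" u'] fmul_Nil[of u']
    by (simp add: reduced_fmul)
  then have "fmul (winv r) [] = relabel (cj (kappa k)) w"
    using fmul_winv_left[OF sw, of r] by simp
  moreover have "reduced (winv r)"
    using ur r by (auto simp: winv_def successively_rev successively_map successively_append_iff
        elim: successively_mono)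
  ultimately have "winv r = relabel (cj (kappa k)) w" using fmul_Nil by metis
  then have len: "length r = length w" by (metis length_map winv_simps(4))
  \<comment> \<open>Both \<open>w @ u'\<close> and \<open>u\<close> are prefixes of this word, and
    they have equal length.\<close>
  have "concat (replicate n w) @ w = w @ concat (replicate n w)"
    by (induction n) auto
  moreover have "prefix u (concat (replicate n w) @ w)" using pu by (rule prefix_prefix)
  moreover have "prefix u' (concat (replicate n w))"
    using pu r by (auto dest: append_prefixD)
  then have "prefix (w @ u') (w @ concat (replicate n w))" by simp
  ultimately have "w @ u' = u"
    using len r by (metis prefix_length_prefix prefix_order.antisym length_append add.commute order_refl)
  then have "fmul w u' = u" using fmul_reduced_append ur by metis
  then have "act g u' = u" using act_kernel[OF g \<open>reduced u'\<close>] by (simp only: w(1))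
  moreover have "act (inv k \<otimes> (g \<otimes> (k \<otimes> g))) [] = act (inv k) (act g u')"
    unfolding u'_def using k kg g(1) by (simp only: act_mult inv_closed m_closed reduced_act successively.simps)
  moreover have "act (inv k) u = []" unfolding u_def using k by simp
  ultimately have "act (inv k \<otimes> (g \<otimes> (k \<otimes> g))) [] = []" by simp
  moreover have "kappa (inv k \<otimes> (g \<otimes> (k \<otimes> g))) = \<one>" using k g by simp
  ultimately have "inv k \<otimes> (g \<otimes> (k \<otimes> g)) = \<one>"
    using kernel_free[of "inv k \<otimes> (g \<otimes> (k \<otimes> g))" "[]"] k g by simp
  then have "(inv k \<otimes> g \<otimes> k) \<otimes> g = \<one>" using k g by (simp add: m_assoc)
  then show ?thesis using k g by (intro inv_equality[symmetric]) auto
qed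

text \<open>Two cylinders of words are nested or disjoint, and every translate is a cylinder or a
  complement of one. The absence of backward copies comes from
  \<open>no_conj_inverse\<close>.\<close>

lemma nested_cut_system_cone: "nested_cut_system G cone g"
proof
  fix h k assume h: "h \<in> carrier G" and k: "k \<in> carrier G"
  let ?C = "\<lambda>u. {z \<in> carrier G. prefix u (act z [])}"
  have nest: "?C a \<subseteq> ?C b \<or> ?C b \<subseteq> ?C a \<or> ?C a \<inter> ?C b = {}" for a b
  proof (cases "prefix a b \<or> prefix b a")
    case True
    then show ?thesis using prefix_order.trans[of a b] prefix_order.trans[of b a] by blast
  next
    case False
    then show ?thesis using prefix_same_cases[of a _ b] by blast
  qed
  have compl: "{z \<in> carrier G. \<not> prefix a (act z [])} = carrier G - ?C a" for a by blast
  show "tr h \<subseteq> tr k \<or> tr k \<subseteq> tr h \<or> tr h \<inter> tr k = {} \<or> carrier G \<subseteq> tr h \<union> tr k"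
  proof (rule tr_cylinder[OF h]; rule tr_cylinder[OF k])
    fix a b assume "tr h = ?C a" "tr k = ?C b"
    then show ?thesis using nest[of a b] by metis
  next
    fix a b assume "tr h = ?C a" "tr k = {z \<in> carrier G. \<not> prefix b (act z [])}"
    then show ?thesis unfolding compl using nest[of a b] by blast
  next
    fix a b assume "tr h = {z \<in> carrier G. \<not> prefix a (act z [])}" "tr k = ?C b"
    then show ?thesis unfolding compl using nest[of a b] by blast
  next
    fix a b assume "tr h = {z \<in> carrier G. \<not> prefix a (act z [])}"
      "tr k = {z \<in> carrier G. \<not> prefix b (act z [])}"
    then show ?thesis unfolding compl using nest[of a b] by blast
  qed
next
  fix x y assume xy: "x \<in> carrier G" "y \<in> carrier G"
  let ?C = "\<lambda>u. {z \<in> carrier G. prefix u (act z [])}" and ?D = "\<lambda>u. {z \<in> carrier G. \<not> prefix u (act z [])}"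
  let ?P = "set (prefixes (act x [])) \<union> set (prefixes (act y []))"
  \<comment> \<open>The word of a separating cylinder is a prefix of the orbit point of
    \<open>y\<close>; for a complement, of that of \<open>x\<close>.\<close>
  have "{tr k |k. k \<in> carrier G \<and> x \<notin> tr k \<and> y \<in> tr k} \<subseteq> ?C ` ?P \<union> ?D ` ?P"
  proof clarify
    fix k assume k: "k \<in> carrier G" "x \<notin> tr k" "y \<in> tr k" "tr k \<notin> ?D ` ?P"
    from tr_cylinder[OF k(1)] show "tr k \<in> ?C ` ?P"
    proof cases
      case (1 u) then show ?thesis using k xy by auto
    next
      case (2 u) then show ?thesis using k xy by auto
    qed
  qed
  then show "finite {tr k |k. k \<in> carrier G \<and> x \<notin> tr k \<and> y \<in> tr k}"
    by (rule finite_subset) simp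
next
  fix k and n :: nat assume k: "k \<in> carrier G"
  have "g \<noteq> \<one>" using w by auto
  then have "inv k \<otimes> g \<otimes> inv (inv k) \<noteq> inv g" using no_conj_inverse[OF g(1)] k by blast
  then show "g [^] n \<in> tr k \<or> \<one> \<notin> tr (k \<otimes> g)"
    using reverse_copy_imp_conj_inverse[OF k] k by auto
qed

end

section \<open>The lower bound for scl\<close>

context raag_group
begin

lemma scl_ge:
  assumes g: "g \<in> carrier G" "g \<noteq> \<one>"
  shows "scl G g \<ge> ereal (1 / 12)"
proof -
  obtain S where S: "finite S" "S \<subseteq> V" "S \<noteq> {}" "rho S g \<noteq> \<one>"
    "\<forall>v\<in>S. rho (- {v}) (rho S g) = \<one>"
    using minimal_support[OF g] .
  then obtain v where vS: "v \<in> S" "v \<in> V" by blast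
  interpret raag_vertex G V E v using vS(2) by (rule vertex_locale)
  have gc: "rho S g \<in> carrier G" using g by simp
  obtain k where k: "k \<in> carrier G" and
    w: "act (inv k \<otimes> rho S g \<otimes> k) [] \<noteq> []"
    "last (act (inv k \<otimes> rho S g \<otimes> k) []) \<noteq> flip (hd (act (inv k \<otimes> rho S g \<otimes> k) []))"
    using cyclically_reduced_conjugate[OF gc bspec[OF S(5) vS(1)] S(4)] .
  \<comment> \<open>Retraction and conjugation form one homomorphism, along which \<open>qm\<close>
    is pulled back to \<open>G\<close> with the same defect.\<close>
  define phi where "phi x = inv k \<otimes> rho S x \<otimes> k" for x
  have kk: "k \<otimes> (inv k \<otimes> x) = x" if "x \<in> carrier G" for x
    using k that by (simp add: m_assoc[symmetric])
  interpret phi: group_hom G G phi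
  proof (intro group_hom.intro group_hom_axioms.intro homI is_group)
    fix x y assume "x \<in> carrier G" "y \<in> carrier G"
    then show "phi (x \<otimes> y) = phi x \<otimes> phi y" using k by (simp add: phi_def m_assoc kk)
  qed (use k in \<open>simp add: phi_def\<close>)
  interpret cyclically_reduced G V E v "phi g" "act (phi g) []"
    by unfold_locales (use g k w bspec[OF S(5) vS(1)] in \<open>simp_all add: phi_def\<close>)
  interpret nested_cut_system G cone "phi g"
    by (rule nested_cut_system_cone)
  \<comment> \<open>Slope 1 from \<open>qm_pow_ge\<close>, defect 3 from
    \<open>qm_defect\<close>.\<close>
  have "scl G g \<ge> ereal (1 / (4 * 3))"
  proof (rule scl_ge_of_quasimorphism[where q = "\<lambda>x. qm (phi x)" and C = 1])
    fix a b assume "a \<in> carrier G" "b \<in> carrier G"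
    then show "\<bar>qm (phi (a \<otimes> b)) - qm (phi a) - qm (phi b)\<bar> \<le> 3" by (simp add: qm_defect)
  next
    fix a assume "a \<in> carrier G"
    then show "qm (phi (inv a)) = - qm (phi a)" by (simp add: qm_inv)
  next
    fix n :: nat
    show "1 * real n - 1 \<le> qm (phi (g [^] n))" using assms qm_pow_ge[of n] by (simp add: phi.hom_nat_pow)
  qed (use assms in simp_all)
  then show ?thesis by simp
qed

end

theorem corollary2:
  fixes V :: "'a set" and E :: "'a set set"
  assumes "simplicial_graph V E"
    and "g \<in> carrier (raag V E)"
    and "g \<noteq> \<one>\<^bsub>raag V E\<^esub>"
  shows "scl (raag V E) g \<ge> 1 / 24"
proof -
  interpret raag_group "raag V E" V E
    by (intro raag_group.intro raag_is_group raag_group_axioms.intro HOL.refl)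
  have "(1 / 24 :: ereal) \<le> ereal (1 / 12)"
    by (simp add: one_ereal_def ereal_divide divide_ereal_def)
  also have "\<dots> \<le> scl (raag V E) g" using assms(2,3) by (rule scl_ge)
  finally show ?thesis .
qed

end
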